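(* Let $P$ be a regular convex $n$-gon with vertices $A_0,\dots,A_{n-1}$ (indices mod $n$), let $l$ be the line perpendicular to the plane of $P$ through its center, and let $O_0\ne O_1$ be points of $l$ not lying in the plane of $P$. Let $\mathcal D$ be the dipyramid with vertices $O_0,O_1$, and let $f\colon\mathcal D\to\mathbb{R}$ be convex on every simplex $O_0O_1A_kA_{k+1}$, $k=0,\dots,n-1$. Then $$\operatorname{Avg}(f,\mathcal D)\le\tfrac14f(O_0)+\tfrac34\operatorname{Avg}(f,\mathcal U_{O_1}),\qquad \operatorname{Avg}(f,\mathcal D)\le\tfrac14f(O_1)+\tfrac34\operatorname{Avg}(f,\mathcal U_{O_0}),$$ $$\operatorname{Avg}(f,h_{O_0}^{3/4}(\mathcal U_{O_1}))\le\operatorname{Avg}(f,\mathcal D),\qquad \operatorname{Avg}(f,h_{O_1}^{3/4}(\mathcal U_{O_0}))\le\operatorname{Avg}(f,\mathcal D),$$ $$\operatorname{Avg}(f,\mathcal D)\le\tfrac12\left(\operatorname{Avg}(f,O_0O_1)+\operatorname{Avg}(f,\partial P)\right),\qquad \operatorname{Avg}(f,\mathcal D)\le\tfrac12\left(\operatorname{Avg}(f,\mathcal S_{O_0})+\operatorname{Avg}(f,\mathcal S_{O_1})\right).$$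
   Context: For a point $X\in l$, the Chinese umbrella with vertex $X$ is $\mathcal U_X=\bigcup_{k=0}^{n-1}\operatorname{conv}\{X,A_k,A_{k+1}\}$ and its scaffold is $\mathcal S_X=\bigcup_{k=0}^{n-1}XA_k$ (union of segments). The dipyramid with vertices $O_0,O_1$ is the body bounded by $\mathcal U_{O_0}$ and $\mathcal U_{O_1}$, i.e. $\mathcal D=\bigcup_{k=0}^{n-1}\operatorname{conv}\{O_0,O_1,A_k,A_{k+1}\}$ (it need not be convex). $\partial P$ is the boundary polygonal line of $P$. $\operatorname{Avg}(f,\mathcal D)$ is the average with respect to volume, averages over umbrellas are with respect to surface area, and averages over segments, $\partial P$ and scaffolds are with respect to length. $h_{\mathbf a}^\lambda(\mathbf x)=\mathbf a+\lambda(\mathbf x-\mathbf a)$. *)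

theory Defs
  imports "HOL-Analysis.Analysis"
begin

definition hom :: "real^3 \<Rightarrow> real \<Rightarrow> real^3 \<Rightarrow> real^3" where
  "hom a lam x = a + lam *\<^sub>R (x - a)"

text \<open>Regular n-gon with centre C, circumradius r, in the plane spanned by the
  orthonormal vectors u, v; vertex A k (indices automatically mod n).\<close>
definition reg_vertex :: "nat \<Rightarrow> real^3 \<Rightarrow> real \<Rightarrow> real^3 \<Rightarrow> real^3 \<Rightarrow> nat \<Rightarrow> real^3" where
  "reg_vertex n C r u v k =
     C + r *\<^sub>R (cos (2 * pi * real k / real n) *\<^sub>R u + sin (2 * pi * real k / real n) *\<^sub>R v)"

definition dipyramid :: "nat \<Rightarrow> (nat \<Rightarrow> real^3) \<Rightarrow> real^3 \<Rightarrow> real^3 \<Rightarrow> (real^3) set" where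
  "dipyramid n A O0 O1 = (\<Union>k<n. convex hull {O0, O1, A k, A (Suc k)})"

definition vol_avg :: "(real^3 \<Rightarrow> real) \<Rightarrow> (real^3) set \<Rightarrow> real" where
  "vol_avg f S = integral S f / measure lebesgue S"

text \<open>Integral with respect to length (1-dimensional measure) over the segment [a,b]:
  the affine parametrisation t \<mapsto> a + t(b-a), t in [0,1], has constant speed |b-a|.\<close>
definition seg_int :: "(real^3 \<Rightarrow> real) \<Rightarrow> real^3 \<Rightarrow> real^3 \<Rightarrow> real" where
  "seg_int f a b = dist a b * integral {0..1} (\<lambda>t. f (a + t *\<^sub>R (b - a)))"

definition std_simplex2 :: "(real^2) set" where
  "std_simplex2 = {p. 0 \<le> p$1 \<and> 0 \<le> p$2 \<and> p$1 + p$2 \<le> 1}"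

text \<open>Area of triangle conv{x,a,b} and integral w.r.t. surface area over it
  (affine parametrisation with constant Jacobian |(a-x) \<times> (b-x)|).\<close>
definition tri_area :: "real^3 \<Rightarrow> real^3 \<Rightarrow> real^3 \<Rightarrow> real" where
  "tri_area x a b = norm (cross3 (a - x) (b - x)) / 2"

definition tri_int :: "(real^3 \<Rightarrow> real) \<Rightarrow> real^3 \<Rightarrow> real^3 \<Rightarrow> real^3 \<Rightarrow> real" where
  "tri_int f x a b = norm (cross3 (a - x) (b - x)) *
     integral std_simplex2 (\<lambda>p. f (x + p$1 *\<^sub>R (a - x) + p$2 *\<^sub>R (b - x)))"

text \<open>Average w.r.t. surface area over the umbrella with vertex X over the
  closed polygon A 0, ..., A (n-1), A n = A 0 (union of triangles conv{X, A k, A (k+1)};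
  distinct triangles meet in sets of zero area).\<close>
definition umbrella_avg :: "(real^3 \<Rightarrow> real) \<Rightarrow> nat \<Rightarrow> real^3 \<Rightarrow> (nat \<Rightarrow> real^3) \<Rightarrow> real" where
  "umbrella_avg f n X A =
     (\<Sum>k<n. tri_int f X (A k) (A (Suc k))) / (\<Sum>k<n. tri_area X (A k) (A (Suc k)))"

definition seg_avg :: "(real^3 \<Rightarrow> real) \<Rightarrow> real^3 \<Rightarrow> real^3 \<Rightarrow> real" where
  "seg_avg f a b = seg_int f a b / dist a b"

definition boundary_avg :: "(real^3 \<Rightarrow> real) \<Rightarrow> nat \<Rightarrow> (nat \<Rightarrow> real^3) \<Rightarrow> real" where
  "boundary_avg f n A =
     (\<Sum>k<n. seg_int f (A k) (A (Suc k))) / (\<Sum>k<n. dist (A k) (A (Suc k)))"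

definition scaffold_avg :: "(real^3 \<Rightarrow> real) \<Rightarrow> nat \<Rightarrow> real^3 \<Rightarrow> (nat \<Rightarrow> real^3) \<Rightarrow> real" where
  "scaffold_avg f n X A = (\<Sum>k<n. seg_int f X (A k)) / (\<Sum>k<n. dist X (A k))"

end

theory Submission
  imports Defs
begin

text \<open>
  The dipyramid is the union of the n congruent tetrahedra with vertices O0, O1, A k, A (k+1), which
  overlap in null sets, so every inequality reduces to one on a single tetrahedron PQRS. There it
  follows from writing a point as (1 - s) p + s q. With p = P, q in the face QRS and density 3 s^2,
  convexity in s gives the bound by vertex and face, and Jensen's inequality at the mean s = 3/4 gives
  the bound by the homothetic face. With p in the edge PQ, q in the opposite edge RS and density
  6 s (1 - s), convexity gives the bound by the two edges; applied to the edges O0 A k and O1 A (k+1)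
  and summed over k, it yields the scaffold inequality.
\<close>

section \<open>Linear changes of variables\<close>

text \<open>A convex function on a tetrahedron is continuous in the interior but may jump on the
  boundary; moreover the definitions use gauge integrals, while Fubini needs Lebesgue integrals.
  Both difficulties are met by integrating over interiors: the frontier of a convex set is
  negligible, and boundedness replaces continuity up to the boundary. A face or an edge lies
  entirely in the boundary, but f restricted to it is again convex, so the same argument applies on
  its own parameter domain.

  The densities are slice areas. The section at parameter s of the cone from P is the face scaled by
  s, whence s^2; the section of the join of two opposite edges is a parallelogram with sides
  proportional to 1 - s and s, whence s (1 - s). The factors 3 and 6 give these densities total mass
  1.

  Regularity of the polygon supplies equal weights: all cells have the same volume, all triangles of
  one umbrella the same area, all edges of one kind the same length. Each average thus becomes a
  plain mean over k of integrals over a fixed parameter domain.\<close>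

lemma prod_Basis_vec: "(\<Prod>b\<in>Basis. g b) = (\<Prod>i\<in>UNIV. g (axis i 1))" for g :: "real^'n \<Rightarrow> real"
proof -
  have B: "Basis = range (\<lambda>i. axis i (1::real) :: real^'n)"
    by (auto simp: Basis_vec_def)
  show ?thesis
    unfolding B by (subst prod.reindex) (auto simp: inj_on_def axis_eq_axis)
qed

lemma prod_3: "prod f (UNIV :: 3 set) = f 1 * f 2 * f 3" for f :: "3 \<Rightarrow> real"
  unfolding UNIV_3 by simp

lemma inner_Basis_le_imp_nth_le:
  fixes l u :: "real^'n"
  assumes "\<And>b. b \<in> Basis \<Longrightarrow> l \<bullet> b \<le> u \<bullet> b"
  shows "l$i \<le> u$i"
  using assms[of "axis i 1"] by (simp add: inner_axis axis_in_Basis_iff)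

lemma continuous_on_vector2 [continuous_intros]:
  fixes f g :: "'a::t2_space \<Rightarrow> real"
  assumes "continuous_on S f" "continuous_on S g"
  shows "continuous_on S (\<lambda>x. vector [f x, g x] :: real^2)"
  unfolding continuous_on_componentwise[of S "\<lambda>x. vector [f x, g x] :: real^2"]
  using assms by (auto simp: Basis_vec_def inner_axis forall_2)

lemma continuous_on_vector3 [continuous_intros]:
  fixes f g h :: "'a::t2_space \<Rightarrow> real"
  assumes "continuous_on S f" "continuous_on S g" "continuous_on S h"
  shows "continuous_on S (\<lambda>x. vector [f x, g x, h x] :: real^3)"
  unfolding continuous_on_componentwise[of S "\<lambda>x. vector [f x, g x, h x] :: real^3"]
  using assms by (auto simp: Basis_vec_def inner_axis forall_3)

text \<open>Both measures give a box the product of its side lengths, which determines Lebesgue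
  measure. The transfer lets Fubini, available on products, act on integrals over
  \<open>real^2\<close>; the next lemma but one does the same for \<open>real^3\<close>.\<close>

lemma lborel_vector2: "distr lborel borel (\<lambda>(x, y). vector [x, y] :: real^2) = lborel"
proof (rule lborel_eqI[symmetric])
  fix l u :: "real^2"
  assume "\<And>b. b \<in> Basis \<Longrightarrow> l \<bullet> b \<le> u \<bullet> b"
  note le = inner_Basis_le_imp_nth_le[OF this]
  have vim: "(\<lambda>(x, y). vector [x, y]) -` box l u = box (l$1, l$2) (u$1, u$2)"
    by (auto simp: mem_box_cart forall_2 mem_box Basis_prod_def)
  have m: "(\<lambda>(x, y). vector [x, y] :: real^2) \<in> borel_measurable borel"
    by (auto intro!: borel_measurable_continuous_onI continuous_intros simp: case_prod_unfold)
  show "emeasure (distr lborel borel (\<lambda>(x, y). vector [x, y])) (box l u) = ennreal (\<Prod>b\<in>Basis. (u - l) \<bullet> b)"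
    using m le unfolding prod_Basis_vec
    by (subst emeasure_distr)
       (auto simp: vim inner_axis emeasure_lborel_box_eq Basis_prod_def UNIV_2)
qed simp

lemma lborel_vector3: "distr lborel borel (\<lambda>(x, y, z). vector [x, y, z] :: real^3) = lborel"
proof (rule lborel_eqI[symmetric])
  fix l u :: "real^3"
  assume "\<And>b. b \<in> Basis \<Longrightarrow> l \<bullet> b \<le> u \<bullet> b"
  note le = inner_Basis_le_imp_nth_le[OF this]
  have B: "(Basis :: (real \<times> real \<times> real) set) = {(1, 0, 0), (0, 1, 0), (0, 0, 1)}"
    by (auto simp: Basis_prod_def zero_prod_def)
  have vim: "(\<lambda>(x, y, z). vector [x, y, z]) -` box l u = box (l$1, l$2, l$3) (u$1, u$2, u$3)"
    by (auto simp: mem_box_cart forall_3 mem_box Basis_prod_def)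
  have m: "(\<lambda>(x, y, z). vector [x, y, z] :: real^3) \<in> borel_measurable borel"
    by (auto intro!: borel_measurable_continuous_onI continuous_intros simp: case_prod_unfold)
  have "emeasure (distr lborel borel (\<lambda>(x, y, z). vector [x, y, z])) (box l u)
      = emeasure lborel (box (l$1, l$2, l$3) (u$1, u$2, u$3))"
    using m by (subst emeasure_distr) (auto simp: vim)
  also have "\<dots> = ennreal (\<Prod>b\<in>Basis. ((u$1, u$2, u$3) - (l$1, l$2, l$3)) \<bullet> b)"
    using le by (intro emeasure_lborel_box) (auto simp: B)
  also have "(\<Prod>b\<in>Basis. ((u$1, u$2, u$3) - (l$1, l$2, l$3)) \<bullet> b) = (\<Prod>b\<in>Basis. (u - l) \<bullet> b)"
    unfolding B prod_Basis_vec prod_3 by (simp add: inner_axis)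
  finally show "emeasure (distr lborel borel (\<lambda>(x, y, z). vector [x, y, z])) (box l u)
    = ennreal (\<Prod>b\<in>Basis. (u - l) \<bullet> b)" .
qed simp

text \<open>It suffices to compare the measures on boxes. The preimage of a box under
  \<open>g\<close> is its image under the inverse map, hence of finite measure, and the scaling law
  for linear images applies to it. As an equality of measures, the rule transports integrability and
  the value of an integral alike.\<close>

lemma lborel_linear:
  fixes g :: "real^'n::{finite,wellorder} \<Rightarrow> real^'n::_"
  assumes g: "linear g" "det (matrix g) \<noteq> 0"
  shows "lborel = density (distr lborel borel g) (\<lambda>_. ennreal \<bar>det (matrix g)\<bar>)"
proof (rule lborel_eqI)
  fix l u :: "real^'n::_"
  assume le: "\<And>b. b \<in> Basis \<Longrightarrow> l \<bullet> b \<le> u \<bullet> b"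
  have "inj g"
    using g det_nz_iff_inj by blast
  then obtain h where h: "linear h" "\<And>x. h (g x) = x" "\<And>x. g (h x) = x"
    using linear_injective_isomorphism[OF g(1)] by metis
  have [measurable]: "g \<in> borel_measurable borel"
    using g(1) by (intro borel_measurable_continuous_onI linear_continuous_on) (simp add: linear_conv_bounded_linear)
  let ?S = "g -` box l u"
  have S: "?S = h ` box l u"
  proof (intro set_eqI iffI)
    show "x \<in> h ` box l u" if "x \<in> ?S" for x
      using that image_eqI[of x h "g x"] h(2) by simp
    show "x \<in> ?S" if "x \<in> h ` box l u" for x
      using that h(3) by auto
  qed
  have meas: "?S \<in> lmeasurable"
    unfolding S using h(1) by (intro measurable_linear_image) auto
  have borel: "?S \<in> sets borel"
    using measurable_sets[of g borel borel "box l u"] by auto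
  have fin: "emeasure lborel ?S < \<infinity>"
    using meas borel by (auto simp: fmeasurable_def)
  have "measure lebesgue (g ` ?S) = \<bar>det (matrix g)\<bar> * measure lebesgue ?S"
    using measure_linear_image[OF g(1) meas] .
  moreover have "g ` ?S = box l u"
    using h(3) by (intro surj_image_vimage_eq) (metis surjI)
  ultimately have m: "measure lborel (box l u) = \<bar>det (matrix g)\<bar> * measure lborel ?S"
    using borel by (simp add: measure_completion)
  have "emeasure (density (distr lborel borel g) (\<lambda>_. ennreal \<bar>det (matrix g)\<bar>)) (box l u)
      = ennreal \<bar>det (matrix g)\<bar> * emeasure lborel ?S"
    by (simp add: emeasure_density nn_integral_cmult_indicator emeasure_distr)
  also have "\<dots> = ennreal (measure lborel (box l u))"
    using fin by (simp add: m emeasure_eq_ennreal_measure ennreal_mult)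
  also have "\<dots> = ennreal (\<Prod>b\<in>Basis. (u - l) \<bullet> b)"
    using le by (simp add: measure_lborel_box_eq)
  finally show "emeasure (density (distr lborel borel g) (\<lambda>_. ennreal \<bar>det (matrix g)\<bar>)) (box l u)
    = ennreal (\<Prod>b\<in>Basis. (u - l) \<bullet> b)" .
qed simp

text \<open>The identity asks for measurability alone because it is applied to every slice of an
  integrable function, and Fubini guarantees integrability of almost every slice only.\<close>

lemma integral_lborel_scale2:
  fixes f :: "real \<times> real \<Rightarrow> real"
  assumes [measurable]: "f \<in> borel_measurable borel" and pq: "p > 0" "q > 0"
  shows "integral\<^sup>L lborel f = p * q * (LINT z|lborel. f (p * fst z, q * snd z))"
proof -
  \<comment> \<open>The map z to (p z1, q z2) in the shape required by
    \<open>lborel_affine_euclidean\<close>, with translation part 0.\<close>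
  let ?c = "\<lambda>j::real\<times>real. if j = (1, 0) then p else q"
  let ?T = "\<lambda>x::real\<times>real. 0 + (\<Sum>j\<in>Basis. (?c j * (x \<bullet> j)) *\<^sub>R j)"
  have T: "?T = (\<lambda>z. (p * fst z, q * snd z))"
    by (auto simp: fun_eq_iff Basis_prod_def sum.union_disjoint)
  have "lborel = density (distr lborel borel ?T) (\<lambda>_. (\<Prod>j\<in>Basis. \<bar>?c j\<bar>))"
    using pq by (intro lborel_affine_euclidean) auto
  also have "(\<Prod>j\<in>Basis. \<bar>?c j\<bar>) = p * q"
    using pq by (auto simp: Basis_prod_def)
  finally have L: "lborel = density (distr lborel borel (\<lambda>z. (p * fst z, q * snd z))) (\<lambda>_. ennreal (p * q))"
    unfolding T .
  have m: "(\<lambda>z::real\<times>real. (p * fst z, q * snd z)) \<in> measurable lborel borel"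
    by (auto intro!: borel_measurable_continuous_onI continuous_intros)
  show ?thesis
    using pq by (subst L) (simp add: integral_density integral_distr[OF m])
qed

text \<open>The parametrization factors into the identification of triples with vectors, the linear
  map \<open>g\<close> with columns \<open>a\<close>, \<open>b\<close>, \<open>c\<close>, and a
  translation. The second alone changes the measure, by the determinant of \<open>g\<close>, which
  is the triple product.\<close>

lemma integrable_lborel_affine3:
  fixes F :: "real^3 \<Rightarrow> real" and a b c P :: "real^3"
  assumes F: "integrable lborel F" and d: "a \<bullet> cross3 b c \<noteq> 0"
  defines "\<psi> \<equiv> \<lambda>w. P + fst w *\<^sub>R a + fst (snd w) *\<^sub>R b + snd (snd w) *\<^sub>R c"
  shows "integrable lborel (\<lambda>w. F (\<psi> w))"
    and "integral\<^sup>L lborel F = \<bar>a \<bullet> cross3 b c\<bar> * (LINT w|lborel. F (\<psi> w))"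
proof -
  define g where "g v = v$1 *\<^sub>R a + v$2 *\<^sub>R b + v$3 *\<^sub>R c" for v :: "real^3"
  have lin: "linear g"
    by (rule linearI) (simp_all add: g_def algebra_simps)
  have det: "det (matrix g) = a \<bullet> cross3 b c"
    by (simp add: det_3 matrix_def g_def axis_def cross3_def inner_vec_def sum_3 vector_def algebra_simps)
  have Fm [measurable]: "F \<in> borel_measurable borel"
    using F by (simp add: borel_measurable_integrable)
  have m1: "(+) P \<in> measurable lborel borel"
    by simp
  have m2: "g \<in> measurable lborel borel"
    using lin by (auto intro!: borel_measurable_continuous_onI linear_continuous_on simp: linear_conv_bounded_linear)
  have m3: "(\<lambda>(x, y, z). vector [x, y, z] :: real^3) \<in> measurable lborel borel"
    by (auto intro!: borel_measurable_continuous_onI continuous_intros simp: case_prod_unfold)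
  have \<psi>: "\<psi> w = P + g (case w of (x, y, z) \<Rightarrow> vector [x, y, z])" for w
    by (simp add: \<psi>_def g_def case_prod_unfold add.assoc)
  have gm [measurable]: "g \<in> borel_measurable borel"
    using m2 by simp
  have F1: "integrable lborel (\<lambda>x. F (P + x))" "integral\<^sup>L lborel F = (LINT x|lborel. F (P + x))"
    using F integrable_distr[OF m1, of F] integral_distr[OF m1 Fm] by (simp_all add: lborel_distr_plus)
  have "integrable (density (distr lborel borel g) (\<lambda>_. ennreal \<bar>det (matrix g)\<bar>)) (\<lambda>x. F (P + x))"
    using F1(1) lborel_linear[OF lin] d det by simp
  then have "integrable (distr lborel borel g) (\<lambda>x. F (P + x))"
    using d det by (subst (asm) integrable_density) auto
  then have F2: "integrable lborel (\<lambda>x. F (P + g x))"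
    by (rule integrable_distr[OF m2])
  have "(LINT x|lborel. F (P + x)) = (LINT x|density (distr lborel borel g) (\<lambda>_. ennreal \<bar>det (matrix g)\<bar>). F (P + x))"
    using lborel_linear[OF lin] d det by simp
  also have "\<dots> = \<bar>det (matrix g)\<bar> * (LINT x|distr lborel borel g. F (P + x))"
    by (subst integral_density) auto
  also have "(LINT x|distr lborel borel g. F (P + x)) = (LINT x|lborel. F (P + g x))"
    by (rule integral_distr[OF m2]) simp
  finally have G2: "(LINT x|lborel. F (P + x)) = \<bar>a \<bullet> cross3 b c\<bar> * (LINT x|lborel. F (P + g x))"
    by (simp add: det)
  show "integrable lborel (\<lambda>w. F (\<psi> w))"
    unfolding \<psi> using F2 by (intro integrable_distr[OF m3]) (simp add: lborel_vector3)
  have "(LINT x|lborel. F (P + g x)) = (LINT w|lborel. F (\<psi> w))"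
    unfolding \<psi> by (subst integral_distr[OF m3, symmetric]) (simp_all add: lborel_vector3)
  then show "integral\<^sup>L lborel F = \<bar>a \<bullet> cross3 b c\<bar> * (LINT w|lborel. F (\<psi> w))"
    using F1(2) G2 by simp
qed

section \<open>Integrability of convex functions\<close>

lemma integrable_bounded_support:
  fixes f :: "'a::euclidean_space \<Rightarrow> real"
  assumes [measurable]: "f \<in> borel_measurable borel" and "bounded S"
    and le: "\<And>x. x \<in> S \<Longrightarrow> \<bar>f x\<bar> \<le> B" and 0: "\<And>x. x \<notin> S \<Longrightarrow> f x = 0"
  shows "integrable lborel f"
proof -
  obtain a where a: "S \<subseteq> cbox (- a) a"
    using bounded_subset_cbox_symmetric[OF \<open>bounded S\<close>] .
  show ?thesis
  proof (rule Bochner_Integration.integrable_bound)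
    show "integrable lborel (\<lambda>x. \<bar>B\<bar> * indicator (cbox (- a) a) x)"
      by (intro integrable_mult_right integrable_real_indicator) (auto simp: emeasure_lborel_cbox_eq)
    show "AE x in lborel. norm (f x) \<le> norm (\<bar>B\<bar> * indicator (cbox (- a) a) x)"
    proof (rule AE_I2)
      fix x show "norm (f x) \<le> norm (\<bar>B\<bar> * indicator (cbox (- a) a) x)"
        using le[of x] 0[of x] a by (cases "x \<in> S") (auto simp: indicator_def)
    qed
  qed simp
qed

text \<open>The lower bound comes from reflecting \<open>x\<close> through an interior point
  \<open>x0\<close>: with \<delta> small enough for the shrunken reflection \<open>y\<close> to stay
  in a ball around \<open>x0\<close> inside \<open>S\<close>, the point \<open>x0\<close> is a
  convex combination of \<open>x\<close> and \<open>y\<close>. A very negative \<open>f x\<close>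
  would then force \<open>f y\<close> above \<open>B\<close>.\<close>

lemma convex_on_bounded:
  fixes f :: "'a::euclidean_space \<Rightarrow> real"
  assumes f: "convex_on S f" and S: "bounded S" "interior S \<noteq> {}" and B: "\<And>x. x \<in> S \<Longrightarrow> f x \<le> B"
  obtains M where "\<And>x. x \<in> S \<Longrightarrow> \<bar>f x\<bar> \<le> M"
proof -
  obtain x0 e where e: "e > 0" "cball x0 e \<subseteq> S"
    using S(2) by (metis ex_in_conv mem_interior_cball)
  obtain N where N: "N > 0" "\<And>x. x \<in> S \<Longrightarrow> norm (x - x0) \<le> N"
    using bounded_translation_minus[OF S(1), of x0] unfolding bounded_pos by auto
  define \<delta> where "\<delta> = e / N"
  have \<delta>: "\<delta> > 0" using e N by (simp add: \<delta>_def)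
  have x0: "x0 \<in> S" using e by auto
  \<comment> \<open>The solution for \<open>f x\<close> of (1 + \<delta>) f(x0) = B + \<delta> f(x),
    the extreme case of the convexity inequality.\<close>
  define L where "L = ((1 + \<delta>) * f x0 - B) / \<delta>"
  have "L \<le> f x" if x: "x \<in> S" for x
  proof -
    define y where "y = x0 - \<delta> *\<^sub>R (x - x0)"
    have "dist x0 y = \<delta> * norm (x - x0)"
      using \<delta> by (simp add: y_def dist_norm)
    also have "\<dots> \<le> \<delta> * N"
      using N(2)[OF x] \<delta> by simp
    also have "\<dots> = e"
      using N(1) by (simp add: \<delta>_def)
    finally have y: "y \<in> S"
      using e by auto
    have x0_eq: "x0 = (1 / (1 + \<delta>)) *\<^sub>R y + (\<delta> / (1 + \<delta>)) *\<^sub>R x"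
    proof -
      have "(1 + \<delta>) *\<^sub>R ((1 / (1 + \<delta>)) *\<^sub>R y + (\<delta> / (1 + \<delta>)) *\<^sub>R x) = y + \<delta> *\<^sub>R x"
        using \<delta> by (simp add: scaleR_right_distrib)
      also have "\<dots> = (1 + \<delta>) *\<^sub>R x0"
        by (simp add: y_def algebra_simps)
      finally show ?thesis using \<delta> by simp
    qed
    have "f x0 \<le> (1 / (1 + \<delta>)) * f y + (\<delta> / (1 + \<delta>)) * f x"
      using \<delta> convex_onD[OF f, of "\<delta> / (1 + \<delta>)" y x] x y by (subst x0_eq) (simp add: field_simps)
    then have "(1 + \<delta>) * f x0 \<le> (1 + \<delta>) * ((1 / (1 + \<delta>)) * f y + (\<delta> / (1 + \<delta>)) * f x)"
      using \<delta> by (intro mult_left_mono) auto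
    also have "\<dots> = f y + \<delta> * f x"
      using \<delta> by (simp add: distrib_left)
    finally have "(1 + \<delta>) * f x0 \<le> f y + \<delta> * f x" .
    then show ?thesis
      using \<delta> B[OF y] by (simp add: L_def field_simps)
  qed
  then have "\<bar>f x\<bar> \<le> \<bar>B\<bar> + \<bar>L\<bar>" if "x \<in> S" for x
    using B[OF that] that by fastforce
  then show thesis
    by (rule that)
qed

text \<open>On the interior \<open>f\<close> is continuous and bounded, so its cut-off there is
  Borel and integrable. The frontier of a convex set is negligible, so the gauge integral over all
  of \<open>S\<close> has the same value, whatever \<open>f\<close> does on the frontier. Having
  both forms of the integral is the bridge between the definitions and Fubini.\<close>

lemma convex_on_integrable:
  fixes f :: "'a::euclidean_space \<Rightarrow> real"
  assumes f: "convex_on S f" and S: "bounded S" and B: "\<And>x. x \<in> S \<Longrightarrow> f x \<le> B"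
  shows "set_integrable lborel (interior S) f"
    and "(f has_integral (LINT x:interior S|lborel. f x)) S"
proof -
  have cvx: "convex S" using f by (simp add: convex_on_def)
  have "continuous_on (interior S) f"
    using f by (intro convex_on_continuous) (auto intro: convex_on_subset[OF f interior_subset] convex_interior cvx)
  then have m: "(\<lambda>x. indicator (interior S) x *\<^sub>R f x) \<in> borel_measurable borel"
    by (intro borel_measurable_continuous_on_indicator) auto
  show int: "set_integrable lborel (interior S) f"
  proof (cases "interior S = {}")
    case False
    obtain M where "\<And>x. x \<in> S \<Longrightarrow> \<bar>f x\<bar> \<le> M"
      using convex_on_bounded[OF f S False B] by blast
    then show ?thesis
      unfolding set_integrable_def using m interior_subset[of S]
      by (intro integrable_bounded_support[where S = "interior S" and B = M])
         (auto intro: bounded_subset[OF S] simp: indicator_def)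
  qed (simp add: set_integrable_def)
  have "(f has_integral (LINT x:interior S|lborel. f x)) (interior S)"
    using set_borel_integral_eq_integral[OF int] by (simp add: has_integral_iff)
  then show "(f has_integral (LINT x:interior S|lborel. f x)) S"
    by (simp add: has_integral_interior negligible_convex_frontier cvx)
qed

section \<open>Tetrahedra in cone and join coordinates\<close>

lemma cross3_Cramer:
  "(a \<bullet> cross3 b c) *\<^sub>R v = (v \<bullet> cross3 b c) *\<^sub>R a + (v \<bullet> cross3 c a) *\<^sub>R b + (v \<bullet> cross3 a b) *\<^sub>R c"
  for a b c v :: "real^3"
  by (simp add: vec_eq_iff forall_3 cross3_def inner_vec_def sum_3 algebra_simps)

lemma interior_affine_image3:
  fixes a b c P :: "real^3"
  assumes d: "a \<bullet> cross3 b c \<noteq> 0"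
  defines "\<psi> \<equiv> \<lambda>w. P + fst w *\<^sub>R a + fst (snd w) *\<^sub>R b + snd (snd w) *\<^sub>R c"
  shows "inj \<psi>" and "interior (\<psi> ` E) = \<psi> ` interior E"
proof -
  define g where "g w = fst w *\<^sub>R a + fst (snd w) *\<^sub>R b + snd (snd w) *\<^sub>R c" for w :: "real \<times> real \<times> real"
  have lin: "linear g"
    by (rule linearI) (simp_all add: g_def algebra_simps)
  \<comment> \<open>The inverse of \<open>g\<close>, written out by Cramer's rule.\<close>
  define h where "h v = (v \<bullet> cross3 b c / (a \<bullet> cross3 b c), v \<bullet> cross3 c a / (a \<bullet> cross3 b c),
    v \<bullet> cross3 a b / (a \<bullet> cross3 b c))" for v
  have coords: "g w \<bullet> cross3 b c = fst w * (a \<bullet> cross3 b c)"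
      "g w \<bullet> cross3 c a = fst (snd w) * (a \<bullet> cross3 b c)"
      "g w \<bullet> cross3 a b = snd (snd w) * (a \<bullet> cross3 b c)" for w
    by (simp_all add: g_def cross3_def inner_vec_def sum_3 algebra_simps)
  have hg: "h (g w) = w" for w
    using d by (simp add: h_def coords)
  have gh: "g (h v) = v" for v
  proof -
    have "(a \<bullet> cross3 b c) *\<^sub>R g (h v) =
        (v \<bullet> cross3 b c) *\<^sub>R a + (v \<bullet> cross3 c a) *\<^sub>R b + (v \<bullet> cross3 a b) *\<^sub>R c"
      using d by (simp add: g_def h_def scaleR_right_distrib)
    also have "\<dots> = (a \<bullet> cross3 b c) *\<^sub>R v"
      by (rule cross3_Cramer[symmetric])
    finally show ?thesis using d by simp
  qed
  have bij: "bij g"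
    by (rule bij_betw_byWitness[where f' = h]) (auto simp: hg gh)
  have \<psi>: "\<psi> = (+) P \<circ> g"
    by (simp add: \<psi>_def g_def fun_eq_iff add.assoc)
  show "inj \<psi>"
    unfolding \<psi> using bij by (intro inj_compose) (auto simp: bij_is_inj)
  show "interior (\<psi> ` E) = \<psi> ` interior E"
    unfolding \<psi> image_comp[symmetric] interior_translation interior_bijective_linear_image[OF lin bij] ..
qed

lemma has_integral_affine_image3:
  fixes a b c P :: "real^3" and f :: "real^3 \<Rightarrow> real"
  defines "\<psi> \<equiv> \<lambda>w. P + fst w *\<^sub>R a + fst (snd w) *\<^sub>R b + snd (snd w) *\<^sub>R c"
  assumes d: "a \<bullet> cross3 b c \<noteq> 0"
    and f: "convex_on (\<psi> ` E) f" "bounded (\<psi> ` E)" "\<And>x. x \<in> \<psi> ` E \<Longrightarrow> f x \<le> B"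
  shows "integrable lborel (\<lambda>w. indicator (interior E) w * f (\<psi> w))"
    and "(f has_integral \<bar>a \<bullet> cross3 b c\<bar> * (LINT w|lborel. indicator (interior E) w * f (\<psi> w))) (\<psi> ` E)"
proof -
  let ?F = "\<lambda>x. indicator (interior (\<psi> ` E)) x *\<^sub>R f x"
  have \<psi>_apply: "P + fst w *\<^sub>R a + fst (snd w) *\<^sub>R b + snd (snd w) *\<^sub>R c = \<psi> w" for w
    by (simp add: \<psi>_def)
  have F: "integrable lborel ?F"
    using convex_on_integrable(1)[OF f] by (simp add: set_integrable_def)
  have ind: "?F (\<psi> w) = indicator (interior E) w * f (\<psi> w)" for w
    using interior_affine_image3[OF d, of P] unfolding \<psi>_def[symmetric]
    by (simp add: indicator_def inj_image_mem_iff)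
  show "integrable lborel (\<lambda>w. indicator (interior E) w * f (\<psi> w))"
    using integrable_lborel_affine3(1)[OF F d, of P] unfolding \<psi>_apply ind .
  have "integral\<^sup>L lborel ?F = \<bar>a \<bullet> cross3 b c\<bar> * (LINT w|lborel. indicator (interior E) w * f (\<psi> w))"
    using integrable_lborel_affine3(2)[OF F d, of P] unfolding \<psi>_apply ind .
  then show "(f has_integral \<bar>a \<bullet> cross3 b c\<bar> * (LINT w|lborel. indicator (interior E) w * f (\<psi> w))) (\<psi> ` E)"
    using convex_on_integrable(2)[OF f] by (simp add: set_lebesgue_integral_def)
qed

text \<open>Fubini over the coordinate s, followed by a rescaling of each slice that makes its
  domain independent of s. The Jacobian \<open>p s * q s\<close> of the rescaling is the origin of
  the weights s * s (cone) and (1 - s) * s (join).\<close>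

lemma integral_lborel_sliced:
  fixes H :: "real \<times> real \<times> real \<Rightarrow> real"
  assumes H: "integrable lborel H"
    and pos: "\<And>s. s \<in> {0<..<1} \<Longrightarrow> p s > 0" "\<And>s. s \<in> {0<..<1} \<Longrightarrow> q s > 0"
    and 0: "\<And>s z. s \<notin> {0<..<1} \<Longrightarrow> H (s, z) = 0"
  defines "G \<equiv> \<lambda>s. indicator {0<..<1} s * (p s * q s * (LINT z|lborel. H (s, p s * fst z, q s * snd z)))"
  shows "integrable lborel G" and "integral\<^sup>L lborel H = integral\<^sup>L lborel G"
proof -
  have m: "(\<lambda>z. H (s, z)) \<in> borel_measurable borel" for s
    using borel_measurable_integrable[OF H]
    by (intro measurable_compose[where f = "Pair s" and g = H and N = borel])
       (auto intro!: borel_measurable_continuous_onI continuous_intros)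
  have G: "G = (\<lambda>s. LINT z|lborel. H (s, z))"
  proof
    fix s show "G s = (LINT z|lborel. H (s, z))"
      using integral_lborel_scale2[OF m[of s] pos] 0[of s] by (cases "s \<in> {0<..<1}") (auto simp: G_def)
  qed
  have H': "integrable (lborel \<Otimes>\<^sub>M lborel) H"
    using H by (simp add: lborel_prod)
  show "integrable lborel G"
    unfolding G by (rule lborel_pair.integrable_fst'[OF H'])
  show "integral\<^sup>L lborel H = integral\<^sup>L lborel G"
    unfolding G by (subst lborel_pair.integral_fst'[OF H']) (simp add: lborel_prod)
qed

lemma convex_combination4:
  assumes "convex C" "a \<in> C" "b \<in> C" "c \<in> C" "d \<in> C"
    and nn: "\<alpha> \<ge> 0" "\<beta> \<ge> 0" "\<gamma> \<ge> 0" "\<delta> \<ge> 0" "\<alpha> + \<beta> + \<gamma> + \<delta> = 1"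
  shows "\<alpha> *\<^sub>R a + \<beta> *\<^sub>R b + \<gamma> *\<^sub>R c + \<delta> *\<^sub>R d \<in> C"
proof -
  have "(\<Sum>i<4. ([\<alpha>, \<beta>, \<gamma>, \<delta>] ! i) *\<^sub>R ([a, b, c, d] ! i)) \<in> C"
    using assms by (intro convex_sum) (auto simp: numeral_eq_Suc less_Suc_eq)
  then show ?thesis
    by (simp add: numeral_eq_Suc)
qed

definition open_triangle :: "(real \<times> real) set" where
  "open_triangle = {z. 0 < fst z \<and> 0 < snd z \<and> fst z + snd z < 1}"

definition closed_triangle :: "(real \<times> real) set" where
  "closed_triangle = {z. 0 \<le> fst z \<and> 0 \<le> snd z \<and> fst z + snd z \<le> 1}"

text \<open>The half-space form yields convexity and the interior together, since interiors commute
  with finite intersections. The same device serves the other parameter domains.\<close>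

lemma closed_triangle_halfspaces:
  "closed_triangle = {z. (-1, 0) \<bullet> z \<le> 0} \<inter> {z. (0, -1) \<bullet> z \<le> 0} \<inter> {z. (1, 1) \<bullet> z \<le> 1}"
  by (auto simp: closed_triangle_def inner_prod_def)

lemma interior_closed_triangle: "interior closed_triangle = open_triangle"
  unfolding closed_triangle_halfspaces interior_Int
  by (subst interior_halfspace_le, simp add: zero_prod_def)+ (auto simp: open_triangle_def inner_prod_def)

lemma convex_closed_triangle: "convex closed_triangle"
  unfolding closed_triangle_halfspaces by (intro convex_Int convex_halfspace_le)

lemma bounded_closed_triangle: "bounded closed_triangle"
  by (rule bounded_subset[OF bounded_cbox[of "(0, 0)" "(1, 1)"]]) (auto simp: closed_triangle_def cbox_Pair_eq)

text \<open>
  Coordinates (s, x, y): in the cone domain, x = s a and y = s b with (a, b) in the triangle; in the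
  join domain, x = (1 - s) a and y = s b with (a, b) in the unit square.
\<close>

definition cone_domain :: "(real \<times> real \<times> real) set" where
  "cone_domain = {w. 0 \<le> fst (snd w) \<and> 0 \<le> snd (snd w) \<and> fst (snd w) + snd (snd w) \<le> fst w \<and> fst w \<le> 1}"

definition join_domain :: "(real \<times> real \<times> real) set" where
  "join_domain = {w. 0 \<le> fst (snd w) \<and> 0 \<le> snd (snd w) \<and> fst (snd w) \<le> 1 - fst w \<and> snd (snd w) \<le> fst w}"

lemma cone_domain_halfspaces:
  "cone_domain = {w. (0, -1, 0) \<bullet> w \<le> 0} \<inter> {w. (0, 0, -1) \<bullet> w \<le> 0} \<inter> {w. (-1, 1, 1) \<bullet> w \<le> 0} \<inter> {w. (1, 0, 0) \<bullet> w \<le> 1}"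
  by (auto simp: cone_domain_def inner_prod_def)

lemma join_domain_halfspaces:
  "join_domain = {w. (0, -1, 0) \<bullet> w \<le> 0} \<inter> {w. (0, 0, -1) \<bullet> w \<le> 0} \<inter> {w. (1, 1, 0) \<bullet> w \<le> 1} \<inter> {w. (-1, 0, 1) \<bullet> w \<le> 0}"
  by (auto simp: join_domain_def inner_prod_def)

lemma convex_cone_domain: "convex cone_domain" and convex_join_domain: "convex join_domain"
  unfolding cone_domain_halfspaces join_domain_halfspaces by (intro convex_Int convex_halfspace_le)+

lemma interior_cone_domain: "interior cone_domain =
    {w. 0 < fst (snd w) \<and> 0 < snd (snd w) \<and> fst (snd w) + snd (snd w) < fst w \<and> fst w < 1}"
  unfolding cone_domain_halfspaces interior_Int
  by (subst interior_halfspace_le, simp add: zero_prod_def)+ (auto simp: inner_prod_def)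

lemma interior_join_domain: "interior join_domain =
    {w. 0 < fst (snd w) \<and> 0 < snd (snd w) \<and> fst (snd w) < 1 - fst w \<and> snd (snd w) < fst w}"
  unfolding join_domain_halfspaces interior_Int
  by (subst interior_halfspace_le, simp add: zero_prod_def)+ (auto simp: inner_prod_def)

lemma has_bochner_integral_unit_interval:
  fixes h F :: "real \<Rightarrow> real"
  assumes F: "\<And>x. 0 \<le> x \<Longrightarrow> x \<le> 1 \<Longrightarrow> DERIV F x :> h x" and h: "continuous_on {0..1} h"
    and c: "F 1 - F 0 = c"
  shows "has_bochner_integral lborel (\<lambda>s. indicator {0<..<1} s * h s) c"
proof -
  \<comment> \<open>Clamping the argument to [0, 1] extends \<open>h\<close> continuously to the
    whole line, which gives measurability although \<open>h\<close> is controlled on the unit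
    interval only.\<close>
  have "continuous_on UNIV (\<lambda>x. h (max 0 (min 1 x)))"
    by (rule continuous_on_compose2[OF h]) (auto intro!: continuous_intros)
  then have m [measurable]: "(\<lambda>x. h (max 0 (min 1 x))) \<in> borel_measurable borel"
    by (rule borel_measurable_continuous_onI)
  have "has_bochner_integral lborel (\<lambda>x. indicator {0..1} x *\<^sub>R h x) (F 1 - F 0)"
    using integral_FTC_atLeastAtMost[of 0 1 F h] borel_integrable_atLeastAtMost'[OF h] h F
    by (auto simp: has_bochner_integral_iff set_integrable_def
        simp flip: has_real_derivative_iff_has_vector_derivative intro: DERIV_subset)
  also have "?this \<longleftrightarrow> has_bochner_integral lborel (\<lambda>s. indicator {0<..<1} s * h (max 0 (min 1 s))) (F 1 - F 0)"
  proof (rule has_bochner_integral_cong_AE)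
    show "(\<lambda>x. indicator {0..1} x *\<^sub>R h x) \<in> borel_measurable lborel"
      using borel_measurable_continuous_on_indicator[of "{0..1}" h] h by simp
    have "AE x in lborel. x \<noteq> (0::real) \<and> x \<noteq> 1"
      using AE_lborel_singleton[of "0::real"] AE_lborel_singleton[of "1::real"] by eventually_elim auto
    then show "AE x in lborel. indicator {0..1} x *\<^sub>R h x = indicator {0<..<1} x * h (max 0 (min 1 x))"
      by eventually_elim (auto simp: indicator_def)
  qed measurable
  also have "(\<lambda>s. indicator {0<..<1} s * h (max 0 (min 1 s))) = (\<lambda>s. indicator {0<..<1} s * h s)"
    by (auto simp: fun_eq_iff indicator_def)
  finally show ?thesis unfolding c .
qed

lemma convex_on_affine_compose:
  assumes "convex_on T f" "convex K" "\<And>x. x \<in> K \<Longrightarrow> L x \<in> T"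
    and "\<And>t x y. L ((1 - t) *\<^sub>R x + t *\<^sub>R y) = (1 - t) *\<^sub>R L x + t *\<^sub>R L y"
  shows "convex_on K (\<lambda>x. f (L x))"
  using assms by (intro convex_onI) (auto intro: convex_onD)

lemma convex_affine_image3:
  fixes a b c P :: "'a::real_vector"
  assumes "convex E"
  shows "convex ((\<lambda>w. P + fst w *\<^sub>R a + fst (snd w) *\<^sub>R b + snd (snd w) *\<^sub>R c) ` E)"
proof -
  have "linear (\<lambda>w::real\<times>real\<times>real. fst w *\<^sub>R a + fst (snd w) *\<^sub>R b + snd (snd w) *\<^sub>R c)"
    by (rule linearI) (simp_all add: algebra_simps)
  from convex_translation[OF convex_linear_image[OF this assms], of P] show ?thesis
    by (simp add: image_image add.assoc)
qed

text \<open>The barycentric weights of the image point are 1 - s, s - x - y, x, y at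
  \<open>P\<close>, \<open>Q\<close>, \<open>R\<close>, \<open>S\<close>; \<open>cone_domain\<close>
  states that they are nonnegative.\<close>

lemma convex_hull_eq_cone:
  "convex hull {P, Q, R, S} =
    (\<lambda>w. P + fst w *\<^sub>R (Q - P) + fst (snd w) *\<^sub>R (R - Q) + snd (snd w) *\<^sub>R (S - Q)) ` cone_domain"
  (is "?T = ?\<psi> ` _")
proof
  have "P = ?\<psi> (0, 0, 0)" "Q = ?\<psi> (1, 0, 0)" "R = ?\<psi> (1, 1, 0)" "S = ?\<psi> (1, 0, 1)"
    by (simp_all add: algebra_simps)
  moreover have "{(0, 0, 0), (1, 0, 0), (1, 1, 0), (1, 0, 1)} \<subseteq> cone_domain"
    by (auto simp: cone_domain_def)
  ultimately have "{P, Q, R, S} \<subseteq> ?\<psi> ` cone_domain"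
    by blast
  then show "?T \<subseteq> ?\<psi> ` cone_domain"
    by (rule hull_minimal) (rule convex_affine_image3[OF convex_cone_domain])
  show "?\<psi> ` cone_domain \<subseteq> ?T"
  proof safe
    fix s x y :: real assume "(s, x, y) \<in> cone_domain"
    then have "(1 - s) *\<^sub>R P + (s - x - y) *\<^sub>R Q + x *\<^sub>R R + y *\<^sub>R S \<in> ?T"
      by (intro convex_combination4) (auto simp: cone_domain_def hull_inc)
    then show "?\<psi> (s, x, y) \<in> ?T"
      by (simp add: algebra_simps)
  qed
qed

text \<open>Here the barycentric weights are 1 - s - x, x, s - y, y: mass 1 - s on the edge from
  \<open>P\<close> to \<open>Q\<close> and mass s on the edge from \<open>R\<close> to
  \<open>S\<close>.\<close>

lemma convex_hull_eq_join:
  "convex hull {P, Q, R, S} =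
    (\<lambda>w. P + fst w *\<^sub>R (R - P) + fst (snd w) *\<^sub>R (Q - P) + snd (snd w) *\<^sub>R (S - R)) ` join_domain"
  (is "?T = ?\<psi> ` _")
proof
  have "P = ?\<psi> (0, 0, 0)" "Q = ?\<psi> (0, 1, 0)" "R = ?\<psi> (1, 0, 0)" "S = ?\<psi> (1, 0, 1)"
    by (simp_all add: algebra_simps)
  moreover have "{(0, 0, 0), (0, 1, 0), (1, 0, 0), (1, 0, 1)} \<subseteq> join_domain"
    by (auto simp: join_domain_def)
  ultimately have "{P, Q, R, S} \<subseteq> ?\<psi> ` join_domain"
    by blast
  then show "?T \<subseteq> ?\<psi> ` join_domain"
    by (rule hull_minimal) (rule convex_affine_image3[OF convex_join_domain])
  show "?\<psi> ` join_domain \<subseteq> ?T"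
  proof safe
    fix s x y :: real assume "(s, x, y) \<in> join_domain"
    then have "(1 - s - x) *\<^sub>R P + x *\<^sub>R Q + (s - y) *\<^sub>R R + y *\<^sub>R S \<in> ?T"
      by (intro convex_combination4) (auto simp: join_domain_def hull_inc)
    then show "?\<psi> (s, x, y) \<in> ?T"
      by (simp add: algebra_simps)
  qed
qed

lemma det_cone: "(Q - P) \<bullet> cross3 (R - Q) (S - Q) = (Q - P) \<bullet> cross3 (R - P) (S - P)"
  for P Q R S :: "real^3"
  by (simp add: cross3_def inner_vec_def sum_3 algebra_simps)

text \<open>S - R = (S - P) - (R - P) is a column operation; the sign comes from exchanging the
  columns R - P and Q - P.\<close>

lemma det_join: "(R - P) \<bullet> cross3 (Q - P) (S - R) = - ((Q - P) \<bullet> cross3 (R - P) (S - P))"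
  for P Q R S :: "real^3"
  by (simp add: cross3_def inner_vec_def sum_3 algebra_simps)

text \<open>The order of the vertices carries meaning: \<open>P\<close> is the apex over the face of
  \<open>Q\<close>, \<open>R\<close>, \<open>S\<close>, and the edge \<open>P\<close>,
  \<open>Q\<close> is opposite to the edge \<open>R\<close>, \<open>S\<close>. Reordering the
  vertices of one cell produces the different inequalities.\<close>

locale convex_on_tetrahedron =
  fixes P Q R S :: "real^3" and f :: "real^3 \<Rightarrow> real"
  assumes nondegenerate: "(Q - P) \<bullet> cross3 (R - P) (S - P) \<noteq> 0"
    and convex: "convex_on (convex hull {P, Q, R, S}) f"
begin

definition "T = convex hull {P, Q, R, S}"

text \<open>Six times the volume of the tetrahedron, and at the same time the Jacobian of both
  parametrizations.\<close>

definition "vol6 = \<bar>(Q - P) \<bullet> cross3 (R - P) (S - P)\<bar>"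

definition "face z = Q + fst z *\<^sub>R (R - Q) + snd z *\<^sub>R (S - Q)" for z :: "real \<times> real"

definition "cone_pt s z = P + s *\<^sub>R (Q - P) + (s * fst z) *\<^sub>R (R - Q) + (s * snd z) *\<^sub>R (S - Q)" for s and z :: "real \<times> real"

definition "join_pt s z = P + s *\<^sub>R (R - P) + ((1 - s) * fst z) *\<^sub>R (Q - P) + (s * snd z) *\<^sub>R (S - R)" for s and z :: "real \<times> real"

lemma convex_T: "convex_on T f"
  using convex by (simp add: T_def)

lemma bounded_T: "bounded T"
  by (simp add: T_def bounded_convex_hull)

lemma vertices_T: "P \<in> T" "Q \<in> T" "R \<in> T" "S \<in> T"
  by (auto simp: T_def hull_inc)

lemma comb_T: "\<alpha> \<ge> 0 \<Longrightarrow> \<beta> \<ge> 0 \<Longrightarrow> \<gamma> \<ge> 0 \<Longrightarrow> \<delta> \<ge> 0 \<Longrightarrow> \<alpha> + \<beta> + \<gamma> + \<delta> = 1 \<Longrightarrow>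
    \<alpha> *\<^sub>R P + \<beta> *\<^sub>R Q + \<gamma> *\<^sub>R R + \<delta> *\<^sub>R S \<in> T"
  using convex_combination4[OF _ vertices_T] convex_on_imp_convex[OF convex_T] by blast

lemma f_le: obtains B where "\<And>x. x \<in> T \<Longrightarrow> f x \<le> B"
proof -
  have "\<forall>x\<in>T. f x \<le> \<bar>f P\<bar> + \<bar>f Q\<bar> + \<bar>f R\<bar> + \<bar>f S\<bar>"
    unfolding T_def by (rule convex_on_convex_hull_bound[OF convex]) auto
  then show thesis using that by blast
qed

lemma face_T: "z \<in> closed_triangle \<Longrightarrow> face z \<in> T"
  using comb_T[of 0 "1 - fst z - snd z" "fst z" "snd z"]
  by (simp add: face_def closed_triangle_def algebra_simps)

lemma cone_pt_T: "0 \<le> s \<Longrightarrow> s \<le> 1 \<Longrightarrow> z \<in> closed_triangle \<Longrightarrow> cone_pt s z \<in> T"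
proof -
  assume s: "0 \<le> s" "s \<le> 1" and z: "z \<in> closed_triangle"
  have "s * (1 - fst z - snd z) \<ge> 0"
    using s z by (simp add: closed_triangle_def)
  then show ?thesis
    using s z comb_T[of "1 - s" "s * (1 - fst z - snd z)" "s * fst z" "s * snd z"]
    by (simp add: cone_pt_def closed_triangle_def algebra_simps)
qed

lemma cone_pt_eq: "cone_pt s z = (1 - s) *\<^sub>R P + s *\<^sub>R face z"
  by (simp add: cone_pt_def face_def algebra_simps)

text \<open>At level s the section is the face scaled by s, whence the weight s * s. The joint
  measurability in the third part allows the order of integration to be exchanged in
  \<open>cone_lower\<close>.\<close>

lemma cone_integral:
  shows "integrable lborel (\<lambda>s. indicator {0<..<1} s * (s * s * (LINT z:open_triangle|lborel. f (cone_pt s z))))"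
    and "(f has_integral vol6 * (LINT s|lborel. indicator {0<..<1} s * (s * s * (LINT z:open_triangle|lborel. f (cone_pt s z))))) T"
    and "(\<lambda>w. indicator {0<..<1} (fst w) * (indicator open_triangle (snd w) * f (cone_pt (fst w) (snd w)))) \<in> borel_measurable borel"
proof -
  obtain B where B: "\<And>x. x \<in> T \<Longrightarrow> f x \<le> B"
    using f_le by blast
  let ?\<psi> = "\<lambda>w. P + fst w *\<^sub>R (Q - P) + fst (snd w) *\<^sub>R (R - Q) + snd (snd w) *\<^sub>R (S - Q)"
  let ?H = "\<lambda>w. indicator (interior cone_domain) w * f (?\<psi> w)"
  have T: "T = ?\<psi> ` cone_domain"
    unfolding T_def by (rule convex_hull_eq_cone)
  have d: "(Q - P) \<bullet> cross3 (R - Q) (S - Q) \<noteq> 0" "\<bar>(Q - P) \<bullet> cross3 (R - Q) (S - Q)\<bar> = vol6"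
    unfolding det_cone vol6_def using nondegenerate by auto
  have H: "integrable lborel ?H" "(f has_integral vol6 * integral\<^sup>L lborel ?H) T"
    using has_integral_affine_image3[OF d(1), of P cone_domain f B] convex_T bounded_T B
    unfolding T[symmetric] d(2) by auto
  have eq: "?H (s, s * fst z, s * snd z) = indicator open_triangle z * f (cone_pt s z)" if "s \<in> {0<..<1}" for s z
  proof -
    have "s * fst z + s * snd z < s \<longleftrightarrow> s * (fst z + snd z) < s * 1"
      by (simp add: distrib_left)
    then have "s * fst z + s * snd z < s \<longleftrightarrow> fst z + snd z < 1"
      using that by (simp only: mult_less_cancel_left_pos greaterThanLessThan_iff)
    then have "(s, s * fst z, s * snd z) \<in> interior cone_domain \<longleftrightarrow> z \<in> open_triangle"
      using that by (auto simp: interior_cone_domain open_triangle_def zero_less_mult_iff)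
    then show ?thesis
      by (simp add: indicator_def cone_pt_def)
  qed
  have 0: "?H (s, z) = 0" if "s \<notin> {0<..<1}" for s z
    using that by (auto simp: interior_cone_domain indicator_def)
  note sl = integral_lborel_sliced[of ?H "\<lambda>s. s" "\<lambda>s. s", OF H(1)]
  have G: "(\<lambda>s. indicator {0<..<1} s * (s * s * (LINT z|lborel. ?H (s, s * fst z, s * snd z))))
      = (\<lambda>s. indicator {0<..<1} s * (s * s * (LINT z:open_triangle|lborel. f (cone_pt s z))))"
    (is "?A = ?B")
  proof
    fix s show "?A s = ?B s"
    proof (cases "s \<in> {0<..<1}")
      case True
      then show ?thesis
        by (simp only: eq set_lebesgue_integral_def real_scaleR_def)
    qed (simp add: indicator_def)
  qed
  show "integrable lborel ?B"
    using sl(1) 0 unfolding G by simp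
  show "(f has_integral vol6 * integral\<^sup>L lborel ?B) T"
    using H(2) sl(2) 0 unfolding G by simp
  have Hm: "?H \<in> borel_measurable borel"
    using borel_measurable_integrable[OF H(1)] by simp
  have "(\<lambda>w. ?H (fst w, fst w * fst (snd w), fst w * snd (snd w))) \<in> borel_measurable borel"
    by (rule measurable_compose[OF _ Hm])
       (auto intro!: borel_measurable_continuous_onI continuous_intros)
  then have "(\<lambda>w. indicator ({0<..<1} \<times> UNIV) w * ?H (fst w, fst w * fst (snd w), fst w * snd (snd w))) \<in> borel_measurable borel"
    by (rule borel_measurable_times[rotated]) (auto intro!: borel_measurable_indicator borel_open open_Times)
  also have "(\<lambda>w. indicator ({0<..<1} \<times> UNIV) w * ?H (fst w, fst w * fst (snd w), fst w * snd (snd w)))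
    = (\<lambda>w. indicator {0<..<1} (fst w) * (indicator open_triangle (snd w) * f (cone_pt (fst w) (snd w))))"
    (is "?C = ?D")
  proof
    fix w show "?C w = ?D w"
      using eq[of "fst w" "snd w"] by (cases w) (auto simp: indicator_def)
  qed
  finally show "?D \<in> borel_measurable borel" .
qed


lemma join_pt_T: "0 \<le> s \<Longrightarrow> s \<le> 1 \<Longrightarrow> z \<in> cbox (0, 0) (1, 1) \<Longrightarrow> join_pt s z \<in> T"
proof -
  assume s: "0 \<le> s" "s \<le> 1" and z: "z \<in> cbox (0, 0) (1, 1)"
  have eq: "join_pt s z = ((1 - s) * (1 - fst z)) *\<^sub>R P + ((1 - s) * fst z) *\<^sub>R Q
      + (s * (1 - snd z)) *\<^sub>R R + (s * snd z) *\<^sub>R S"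
    by (simp add: join_pt_def algebra_simps)
  show ?thesis
    unfolding eq by (rule comb_T) (use s z in \<open>auto simp: cbox_Pair_eq\<close>, simp add: algebra_simps)
qed

lemma join_pt_eq:
  "join_pt s z = (1 - s) *\<^sub>R (P + fst z *\<^sub>R (Q - P)) + s *\<^sub>R (R + snd z *\<^sub>R (S - R))"
  by (simp add: join_pt_def algebra_simps)

text \<open>At level s the section is a parallelogram with sides (1 - s)(Q - P) and s (S - R), so
  the unit square parametrizes every slice and the weight is (1 - s) * s.\<close>

lemma join_integral:
  shows "integrable lborel (\<lambda>s. indicator {0<..<1} s * ((1 - s) * s * (LINT z:box (0, 0) (1, 1)|lborel. f (join_pt s z))))"
    and "(f has_integral vol6 * (LINT s|lborel. indicator {0<..<1} s * ((1 - s) * s * (LINT z:box (0, 0) (1, 1)|lborel. f (join_pt s z))))) T"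
proof -
  obtain B where B: "\<And>x. x \<in> T \<Longrightarrow> f x \<le> B"
    using f_le by blast
  let ?\<psi> = "\<lambda>w. P + fst w *\<^sub>R (R - P) + fst (snd w) *\<^sub>R (Q - P) + snd (snd w) *\<^sub>R (S - R)"
  let ?H = "\<lambda>w. indicator (interior join_domain) w * f (?\<psi> w)"
  have T: "T = ?\<psi> ` join_domain"
    unfolding T_def by (rule convex_hull_eq_join)
  have d: "(R - P) \<bullet> cross3 (Q - P) (S - R) \<noteq> 0" "\<bar>(R - P) \<bullet> cross3 (Q - P) (S - R)\<bar> = vol6"
    unfolding det_join vol6_def using nondegenerate by auto
  have H: "integrable lborel ?H" "(f has_integral vol6 * integral\<^sup>L lborel ?H) T"
    using has_integral_affine_image3[OF d(1), of P join_domain f B] convex_T bounded_T B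
    unfolding T[symmetric] d(2) by auto
  have eq: "?H (s, (1 - s) * fst z, s * snd z) = indicator (box (0, 0) (1, 1)) z * f (join_pt s z)" if "s \<in> {0<..<1}" for s z
  proof -
    have s: "0 < 1 - s" "0 < s" using that by auto
    have "(1 - s) * fst z < 1 - s \<longleftrightarrow> fst z < 1" "s * snd z < s \<longleftrightarrow> snd z < 1"
      using mult_less_cancel_left_pos[OF s(1), of "fst z" 1] mult_less_cancel_left_pos[OF s(2), of "snd z" 1] by auto
    moreover have "0 < (1 - s) * fst z \<longleftrightarrow> 0 < fst z" "0 < s * snd z \<longleftrightarrow> 0 < snd z"
      using s by (auto simp: zero_less_mult_iff)
    ultimately have "(s, (1 - s) * fst z, s * snd z) \<in> interior join_domain \<longleftrightarrow> z \<in> box (0, 0) (1, 1)"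
      by (cases z) (auto simp: interior_join_domain mem_box Basis_prod_def)
    then show ?thesis
      by (simp add: indicator_def join_pt_def)
  qed
  have 0: "?H (s, z) = 0" if "s \<notin> {0<..<1}" for s z
    using that by (auto simp: interior_join_domain indicator_def)
  note sl = integral_lborel_sliced[of ?H "\<lambda>s. 1 - s" "\<lambda>s. s", OF H(1)]
  have G: "(\<lambda>s. indicator {0<..<1} s * ((1 - s) * s * (LINT z|lborel. ?H (s, (1 - s) * fst z, s * snd z))))
      = (\<lambda>s. indicator {0<..<1} s * ((1 - s) * s * (LINT z:box (0, 0) (1, 1)|lborel. f (join_pt s z))))"
    (is "?A = ?B")
  proof
    fix s show "?A s = ?B s"
    proof (cases "s \<in> {0<..<1}")
      case True
      then show ?thesis
        by (simp only: eq set_lebesgue_integral_def real_scaleR_def)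
    qed (simp add: indicator_def)
  qed
  show "integrable lborel ?B"
    using sl(1) 0 unfolding G by simp
  show "(f has_integral vol6 * integral\<^sup>L lborel ?B) T"
    using H(2) sl(2) 0 unfolding G by simp
qed

text \<open>Precomposition with an affine map preserves convexity, so integrability holds over the
  parameter set \<open>K\<close> even if \<open>L\<close> sends it into the boundary of
  \<open>T\<close>, where \<open>f\<close> may be discontinuous, or is not injective.\<close>

lemma slice_integrable:
  assumes "convex K" "bounded K" "\<And>z. z \<in> K \<Longrightarrow> L z \<in> T"
    and "\<And>t x y. L ((1 - t) *\<^sub>R x + t *\<^sub>R y) = (1 - t) *\<^sub>R L x + t *\<^sub>R L y"
  shows "set_integrable lborel (interior K) (\<lambda>z. f (L z))"
    and "((\<lambda>z. f (L z)) has_integral (LINT z:interior K|lborel. f (L z))) K"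
proof -
  obtain B where B: "\<And>x. x \<in> T \<Longrightarrow> f x \<le> B"
    using f_le by blast
  have "convex_on K (\<lambda>z. f (L z))"
    by (rule convex_on_affine_compose[OF convex_T]) (use assms in auto)
  from convex_on_integrable[OF this assms(2), of B] B assms(3)
  show "set_integrable lborel (interior K) (\<lambda>z. f (L z))"
    "((\<lambda>z. f (L z)) has_integral (LINT z:interior K|lborel. f (L z))) K"
    by auto
qed

lemma face_integrable: "set_integrable lborel open_triangle (\<lambda>z. f (face z))"
  unfolding interior_closed_triangle[symmetric]
  by (rule slice_integrable[OF convex_closed_triangle bounded_closed_triangle])
     (auto intro: face_T, simp add: face_def algebra_simps)

lemma cone_pt_integrable:
  assumes "0 \<le> s" "s \<le> 1"
  shows "set_integrable lborel open_triangle (\<lambda>z. f (cone_pt s z))"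
  unfolding interior_closed_triangle[symmetric]
  by (rule slice_integrable[OF convex_closed_triangle bounded_closed_triangle])
     (use assms in \<open>auto intro: cone_pt_T\<close>, simp add: cone_pt_def algebra_simps)

lemma join_pt_integrable:
  assumes "0 \<le> s" "s \<le> 1"
  shows "set_integrable lborel (box (0, 0) (1, 1)) (\<lambda>z. f (join_pt s z))"
  unfolding interior_cbox[symmetric]
  by (rule slice_integrable[OF convex_box(1) bounded_cbox])
     (use assms join_pt_T in blast, simp add: join_pt_def algebra_simps)

text \<open>The edge functions are regarded as functions on the square, constant in one variable, so
  that they can be compared with \<open>join_pt\<close> pointwise under one integral. The two edges
  are the levels s = 0 and s = 1 of \<open>join_pt\<close>.\<close>

lemma edge_integrable:
  shows "set_integrable lborel (box (0, 0) (1, 1)) (\<lambda>z::real\<times>real. f (P + fst z *\<^sub>R (Q - P)))"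
    and "set_integrable lborel (box (0, 0) (1, 1)) (\<lambda>z::real\<times>real. f (R + snd z *\<^sub>R (S - R)))"
proof -
  have "P + fst z *\<^sub>R (Q - P) \<in> T" "R + snd z *\<^sub>R (S - R) \<in> T" if "z \<in> cbox (0, 0) (1, 1)" for z :: "real \<times> real"
    using join_pt_T[OF _ _ that, of 0] join_pt_T[OF _ _ that, of 1] by (simp_all add: join_pt_def)
  then show "set_integrable lborel (box (0, 0) (1, 1)) (\<lambda>z::real\<times>real. f (P + fst z *\<^sub>R (Q - P)))"
    and "set_integrable lborel (box (0, 0) (1, 1)) (\<lambda>z::real\<times>real. f (R + snd z *\<^sub>R (S - R)))"
    unfolding interior_cbox[symmetric]
    by (intro slice_integrable[OF convex_box(1) bounded_cbox]; simp add: algebra_simps)+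
qed

end

section \<open>Averages over one tetrahedron\<close>

lemma integrable_mult_unit_interval:
  fixes g w :: "real \<Rightarrow> real"
  assumes g: "set_integrable lborel {0<..<1} g" and w: "continuous_on UNIV w" "\<And>s. 0 < s \<Longrightarrow> s < 1 \<Longrightarrow> \<bar>w s\<bar> \<le> 1"
  shows "integrable lborel (\<lambda>s. indicator {0<..<1} s * (w s * g s))"
proof (rule Bochner_Integration.integrable_bound)
  show "integrable lborel (\<lambda>s. indicator {0<..<1} s *\<^sub>R g s)"
    using g by (simp add: set_integrable_def)
  have "(\<lambda>s. w s * (indicator {0<..<1} s *\<^sub>R g s)) \<in> borel_measurable lborel"
    using borel_measurable_continuous_onI[OF w(1)] borel_measurable_integrable[OF g[unfolded set_integrable_def]]
    by (intro borel_measurable_times) auto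
  then show "(\<lambda>s. indicator {0<..<1} s * (w s * g s)) \<in> borel_measurable lborel"
    by (simp add: mult_ac)
  show "AE s in lborel. norm (indicator {0<..<1} s * (w s * g s)) \<le> norm (indicator {0<..<1} s *\<^sub>R g s)"
    using w(2) by (auto simp: indicator_def abs_mult intro!: AE_I2 mult_left_le_one_le)
qed

lemma convex_on_quadratic_mean_ge:
  fixes g :: "real \<Rightarrow> real"
  assumes g: "convex_on {0..1} g"
  shows "integrable lborel (\<lambda>s. indicator {0<..<1} s * (s * s * g s))"
    and "g (3/4) / 3 \<le> (LINT s|lborel. indicator {0<..<1} s * (s * s * g s))"
proof -
  have B: "g x \<le> max (g 0) (g 1)" if "x \<in> {0..1}" for x
  proof -
    have "g x \<le> (1 - x) * g 0 + x * g 1"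
      using convex_onD[OF g, of x 0 1] that by simp
    also have "\<dots> \<le> (1 - x) * max (g 0) (g 1) + x * max (g 0) (g 1)"
      using that by (intro add_mono mult_left_mono) auto
    finally show ?thesis by (simp add: algebra_simps)
  qed
  have "set_integrable lborel {0<..<1} g"
    using convex_on_integrable(1)[OF g _ B] by simp
  then show int: "integrable lborel (\<lambda>s. indicator {0<..<1} s * (s * s * g s))"
    by (rule integrable_mult_unit_interval) (auto intro!: continuous_intros simp: abs_mult mult_le_one)
  \<comment> \<open>The supporting line at 3/4 suffices because 3/4 is the mean of the density 3 s^2.\<close>
  obtain m where m: "\<And>s. s \<in> {0..1} \<Longrightarrow> g (3/4) + m * (s - 3/4) \<le> g s"
    using convex_le_Inf_differential[OF g, of "3/4"] by (auto simp: interior_atLeastAtMost_real)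
  \<comment> \<open>The linear term contributes m (1/4 - 3/4 * 1/3) = 0, and the constant term has
    total weight 1/3.\<close>
  have lower: "has_bochner_integral lborel (\<lambda>s. indicator {0<..<1} s * (s * s * (g (3/4) + m * (s - 3/4)))) (g (3/4) / 3)"
    by (rule has_bochner_integral_unit_interval[where F = "\<lambda>s. (g (3/4) - 3/4 * m) * s^3 / 3 + m * s^4 / 4"])
       (auto intro!: derivative_eq_intros continuous_intros simp: field_simps power2_eq_square power3_eq_cube)
  show "g (3/4) / 3 \<le> (LINT s|lborel. indicator {0<..<1} s * (s * s * g s))"
    unfolding has_bochner_integral_integral_eq[OF lower, symmetric]
  proof (rule integral_mono)
    show "indicator {0<..<1} s * (s * s * (g (3/4) + m * (s - 3/4))) \<le> indicator {0<..<1} s * (s * s * g s)" for s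
      using m[of s] by (auto simp: indicator_def intro!: mult_left_mono)
  qed (use lower int in \<open>auto simp: has_bochner_integral_iff\<close>)
qed

lemma open_triangle_const:
  "set_integrable lborel open_triangle (\<lambda>_. c :: real)" "(LINT z:open_triangle|lborel. c) = c / 2"
proof -
  show int: "set_integrable lborel open_triangle (\<lambda>_. c)" for c :: real
    unfolding interior_closed_triangle[symmetric]
    by (rule convex_on_integrable(1)[of _ _ c]) (auto simp: convex_on_def convex_closed_triangle bounded_closed_triangle simp flip: distrib_right)
  have i: "integrable (lborel \<Otimes>\<^sub>M lborel) (\<lambda>z. indicator open_triangle z :: real)"
    using int[of 1] by (simp add: set_integrable_def lborel_prod)
  have "(LINT z|lborel. indicator open_triangle z) = (LINT x|lborel. LINT y|lborel. indicator open_triangle (x, y) :: real)"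
    using lborel_pair.integral_fst'[OF i] by (simp add: lborel_prod)
  also have "(\<lambda>x. LINT y|lborel. indicator open_triangle (x, y) :: real) = (\<lambda>x. indicator {0<..<1} x * (1 - x))"
  proof
    fix x :: real
    have "(\<lambda>y. indicator open_triangle (x, y) :: real) = (\<lambda>y. if 0 < x \<and> x < 1 then indicator {0<..<1-x} y else 0)"
      by (auto simp: fun_eq_iff open_triangle_def indicator_def)
    then show "(LINT y|lborel. indicator open_triangle (x, y) :: real) = indicator {0<..<1} x * (1 - x)"
      by (auto simp: indicator_def[of _ x])
  qed
  also have "(LINT x|lborel. indicator {0<..<1} x * (1 - x :: real)) = 1 / 2"
    by (intro has_bochner_integral_integral_eq has_bochner_integral_unit_interval[where F = "\<lambda>x. x - x^2 / 2"])
       (auto intro!: derivative_eq_intros continuous_intros)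
  finally show "(LINT z:open_triangle|lborel. c) = c / 2"
    by (simp add: set_lebesgue_integral_def)
qed

context convex_on_tetrahedron
begin

text \<open>On each segment from \<open>P\<close> to a point of the face, convexity bounds
  \<open>f\<close> by the chord. The chord weights s^2 (1 - s) and s^3 integrate to 1/12 and 1/4,
  and the area 1/2 of the parameter triangle turns 1/12 into 1/24.\<close>

lemma cone_upper:
  "integral T f \<le> vol6 * (f P / 24 + (LINT z:open_triangle|lborel. f (face z)) / 4)"
proof -
  define I where "I = (LINT z:open_triangle|lborel. f (face z))"
  let ?G = "\<lambda>s. indicator {0<..<1} s * (s * s * (LINT z:open_triangle|lborel. f (cone_pt s z)))"
  let ?U = "\<lambda>s. indicator {0<..<1} s * (s * s * ((1 - s) * (f P / 2) + s * I))"
  have slice: "(LINT z:open_triangle|lborel. f (cone_pt s z)) \<le> (1 - s) * (f P / 2) + s * I"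
    if s: "0 < s" "s < 1" for s
  proof -
    have "(LINT z:open_triangle|lborel. f (cone_pt s z)) \<le> (LINT z:open_triangle|lborel. (1 - s) * f P + s * f (face z))"
    proof (rule set_integral_mono)
      show "set_integrable lborel open_triangle (\<lambda>z. (1 - s) * f P + s * f (face z))"
        by (intro set_integral_add(1) open_triangle_const(1) set_integrable_mult_right face_integrable)
      show "f (cone_pt s z) \<le> (1 - s) * f P + s * f (face z)" if "z \<in> open_triangle" for z
        unfolding cone_pt_eq using that s
        by (intro convex_onD[OF convex_T] vertices_T face_T) (auto simp: open_triangle_def closed_triangle_def)
    qed (use cone_pt_integrable s in auto)
    also have "\<dots> = (1 - s) * f P / 2 + s * I"
      unfolding I_def by (subst set_integral_add(2)) (auto intro: open_triangle_const face_integrable simp: open_triangle_const)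
    finally show ?thesis by simp
  qed
  have U: "has_bochner_integral lborel ?U (f P / 24 + I / 4)"
    by (rule has_bochner_integral_unit_interval[where F = "\<lambda>s. (s^3 / 3 - s^4 / 4) * (f P / 2) + s^4 / 4 * I"])
       (auto intro!: derivative_eq_intros continuous_intros simp: field_simps power2_eq_square power3_eq_cube)
  have "integral\<^sup>L lborel ?G \<le> integral\<^sup>L lborel ?U"
  proof (rule integral_mono)
    show "?G s \<le> ?U s" for s
      using slice[of s] by (auto simp: indicator_def intro!: mult_left_mono)
  qed (use cone_integral(1) U in \<open>auto simp: has_bochner_integral_iff\<close>)
  also have "\<dots> = f P / 24 + I / 4"
    using U by (rule has_bochner_integral_integral_eq)
  finally have "integral\<^sup>L lborel ?G \<le> f P / 24 + I / 4" .
  then have "vol6 * integral\<^sup>L lborel ?G \<le> vol6 * (f P / 24 + I / 4)"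
    by (rule mult_left_mono) (simp add: vol6_def)
  then show ?thesis
    using integral_unique[OF cone_integral(2)] by (simp add: I_def)
qed

text \<open>The chord now joins points of two opposite edges. Its weights s (1 - s)^2 and s^2 (1 -
  s) both integrate to 1/12, so the two edges enter symmetrically.\<close>

lemma join_upper:
  "integral T f \<le> vol6 / 12 * ((LINT z:box (0, 0) (1::real, 1::real)|lborel. f (P + fst z *\<^sub>R (Q - P)))
    + (LINT z:box (0, 0) (1::real, 1::real)|lborel. f (R + snd z *\<^sub>R (S - R))))"
proof -
  define I where "I = (LINT z:box (0, 0) (1::real, 1::real)|lborel. f (P + fst z *\<^sub>R (Q - P)))"
  define J where "J = (LINT z:box (0, 0) (1::real, 1::real)|lborel. f (R + snd z *\<^sub>R (S - R)))"
  let ?G = "\<lambda>s. indicator {0<..<1} s * ((1 - s) * s * (LINT z:box (0, 0) (1::real, 1::real)|lborel. f (join_pt s z)))"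
  let ?U = "\<lambda>s. indicator {0<..<1} s * ((1 - s) * s * ((1 - s) * I + s * J))"
  have slice: "(LINT z:box (0, 0) (1::real, 1::real)|lborel. f (join_pt s z)) \<le> (1 - s) * I + s * J"
    if s: "0 < s" "s < 1" for s
  proof -
    have "(LINT z:box (0, 0) (1::real, 1::real)|lborel. f (join_pt s z)) \<le>
      (LINT z:box (0, 0) (1::real, 1::real)|lborel. (1 - s) * f (P + fst z *\<^sub>R (Q - P)) + s * f (R + snd z *\<^sub>R (S - R)))"
    proof (rule set_integral_mono)
      show "set_integrable lborel (box (0, 0) (1, 1))
          (\<lambda>z. (1 - s) * f (P + fst z *\<^sub>R (Q - P)) + s * f (R + snd z *\<^sub>R (S - R)))"
        by (intro set_integral_add(1) set_integrable_mult_right edge_integrable)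
      show "f (join_pt s z) \<le> (1 - s) * f (P + fst z *\<^sub>R (Q - P)) + s * f (R + snd z *\<^sub>R (S - R))"
        if "z \<in> box (0, 0) (1, 1)" for z
        unfolding join_pt_eq using s join_pt_T[of 0 z] join_pt_T[of 1 z] box_subset_cbox that
        by (intro convex_onD[OF convex_T]) (auto simp: join_pt_def)
    qed (use join_pt_integrable s in auto)
    also have "\<dots> = (1 - s) * I + s * J"
      unfolding I_def J_def by (subst set_integral_add(2)) (auto intro: edge_integrable)
    finally show ?thesis .
  qed
  have U: "has_bochner_integral lborel ?U (I / 12 + J / 12)"
    by (rule has_bochner_integral_unit_interval[where F = "\<lambda>s. (s^2 / 2 - 2 * s^3 / 3 + s^4 / 4) * I + (s^3 / 3 - s^4 / 4) * J"])
       (auto intro!: derivative_eq_intros continuous_intros simp: field_simps power2_eq_square power3_eq_cube)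
  have "integral\<^sup>L lborel ?G \<le> integral\<^sup>L lborel ?U"
  proof (rule integral_mono)
    show "?G s \<le> ?U s" for s
      using slice[of s] by (auto simp: indicator_def intro!: mult_left_mono)
  qed (use join_integral(1) U in \<open>auto simp: has_bochner_integral_iff\<close>)
  also have "\<dots> = I / 12 + J / 12"
    using U by (rule has_bochner_integral_integral_eq)
  finally have "integral\<^sup>L lborel ?G \<le> I / 12 + J / 12" .
  then have "vol6 * integral\<^sup>L lborel ?G \<le> vol6 * (I / 12 + J / 12)"
    by (rule mult_left_mono) (simp add: vol6_def)
  then show ?thesis
    using integral_unique[OF join_integral(2)] by (simp add: I_def J_def algebra_simps)
qed

lemma f_bounded: obtains M where "\<And>x. x \<in> T \<Longrightarrow> \<bar>f x\<bar> \<le> M"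
proof -
  obtain B where B: "\<And>x. x \<in> T \<Longrightarrow> f x \<le> B"
    using f_le by blast
  have "(Q - P) \<bullet> cross3 (R - Q) (S - Q) \<noteq> 0"
    unfolding det_cone by (rule nondegenerate)
  note int = interior_affine_image3(2)[OF this, of P cone_domain, folded convex_hull_eq_cone T_def]
  \<comment> \<open>Any point satisfying all the strict inequalities would do; a nonempty interior
    is what the lower bound on \<open>f\<close> requires.\<close>
  have "(1/2, 1/8, 1/8) \<in> interior cone_domain"
    by (simp add: interior_cone_domain)
  then have "interior T \<noteq> {}"
    unfolding int by blast
  then show thesis
    using convex_on_bounded[OF convex_T bounded_T _ B] that by blast
qed

text \<open>Jensen's inequality acts along a fixed ray from \<open>P\<close>, so s has to be the
  inner variable, whereas \<open>cone_integral\<close> has z inside. The exchange needs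
  \<open>J\<close> integrable jointly in both variables; this follows from joint measurability and
  the two-sided bound on \<open>f\<close>.\<close>

lemma cone_lower:
  "vol6 / 3 * (LINT z:open_triangle|lborel. f (cone_pt (3/4) z)) \<le> integral T f"
proof -
  let ?G = "\<lambda>s. indicator {0<..<1} s * (s * s * (LINT z:open_triangle|lborel. f (cone_pt s z)))"
  define J where "J w = fst w * fst w * (indicator {0<..<1} (fst w) * (indicator open_triangle (snd w) * f (cone_pt (fst w) (snd w))))"
    for w
  obtain M where M: "\<And>x. x \<in> T \<Longrightarrow> \<bar>f x\<bar> \<le> M"
    using f_bounded by blast
  have "J \<in> borel_measurable borel"
    unfolding J_def [abs_def]
    by (intro borel_measurable_times cone_integral(3)) (auto intro!: borel_measurable_continuous_onI continuous_intros)
  then have "integrable lborel J"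
  proof (rule integrable_bounded_support[where S = "{0..1} \<times> closed_triangle" and B = M])
    show "bounded ({0..1::real} \<times> closed_triangle)"
      by (intro bounded_Times bounded_closed_triangle) simp
    show "J w = 0" if "w \<notin> {0..1} \<times> closed_triangle" for w
      using that by (cases w) (auto simp: J_def indicator_def open_triangle_def closed_triangle_def)
    show "\<bar>J w\<bar> \<le> M" if w: "w \<in> {0..1} \<times> closed_triangle" for w
    proof -
      have "\<bar>f (cone_pt (fst w) (snd w))\<bar> \<le> M"
        using w by (intro M cone_pt_T) auto
      moreover have "\<bar>J w\<bar> \<le> \<bar>f (cone_pt (fst w) (snd w))\<bar>"
        using w by (auto simp: J_def indicator_def abs_mult intro!: mult_left_le_one_le mult_le_one)
      ultimately show ?thesis by simp
    qed
  qed
  then have J: "integrable (lborel \<Otimes>\<^sub>M lborel) J"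
    by (simp add: lborel_prod)
  have G: "?G = (\<lambda>s. LINT z|lborel. J (s, z))"
    by (auto simp: J_def fun_eq_iff set_lebesgue_integral_def indicator_def[of "{0<..<1}"])
  have inner: "indicator open_triangle z * (f (cone_pt (3/4) z) / 3) \<le> (LINT s|lborel. J (s, z))" for z
  proof (cases "z \<in> open_triangle")
    case True
    then have z: "z \<in> closed_triangle"
      by (auto simp: open_triangle_def closed_triangle_def)
    have "convex_on {0..1} (\<lambda>s. f (cone_pt s z))"
      by (rule convex_on_affine_compose[OF convex_T]) (use z in \<open>auto intro: cone_pt_T\<close>, simp add: cone_pt_def algebra_simps)
    from convex_on_quadratic_mean_ge(2)[OF this] True show ?thesis
      by (simp add: J_def mult_ac)
  qed (simp add: J_def)
  have "(LINT z:open_triangle|lborel. f (cone_pt (3/4) z)) / 3 = (LINT z|lborel. indicator open_triangle z * (f (cone_pt (3/4) z) / 3))"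
    by (simp add: set_lebesgue_integral_def)
  also have "\<dots> \<le> (LINT z|lborel. LINT s|lborel. J (s, z))"
  proof (rule integral_mono)
    show "integrable lborel (\<lambda>z. indicator open_triangle z * (f (cone_pt (3/4) z) / 3))"
      using cone_pt_integrable[of "3/4"] by (simp add: set_integrable_def)
    show "integrable lborel (\<lambda>z. LINT s|lborel. J (s, z))"
      using lborel_pair.integrable_snd[of "\<lambda>s z. J (s, z)"] J by simp
  qed (rule inner)
  also have "\<dots> = (LINT s|lborel. LINT z|lborel. J (s, z))"
    using lborel_pair.Fubini_integral[of "\<lambda>s z. J (s, z)"] J by simp
  also have "\<dots> = integral\<^sup>L lborel ?G"
    by (simp only: G)
  finally have "vol6 * ((LINT z:open_triangle|lborel. f (cone_pt (3/4) z)) / 3) \<le> vol6 * integral\<^sup>L lborel ?G"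
    by (rule mult_left_mono) (simp add: vol6_def)
  then show ?thesis
    using integral_unique[OF cone_integral(2)] by simp
qed

end

section \<open>Surface and length integrals as Lebesgue integrals over parameter domains\<close>

lemma std_simplex2_halfspaces:
  "std_simplex2 = {p. vector [-1, 0] \<bullet> p \<le> 0} \<inter> {p. vector [0, -1] \<bullet> p \<le> 0} \<inter> {p. vector [1, 1] \<bullet> p \<le> 1}"
  by (auto simp: std_simplex2_def inner_vec_def sum_2)

lemma convex_std_simplex2: "convex std_simplex2"
  unfolding std_simplex2_halfspaces by (intro convex_Int convex_halfspace_le)

lemma bounded_std_simplex2: "bounded std_simplex2"
  by (rule bounded_subset[OF bounded_cbox[of 0 1]]) (auto simp: std_simplex2_def mem_box_cart forall_2)

lemma interior_std_simplex2: "interior std_simplex2 = {p. 0 < p$1 \<and> 0 < p$2 \<and> p$1 + p$2 < 1}"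
  unfolding std_simplex2_halfspaces interior_Int
  by (subst interior_halfspace_le, simp add: vec_eq_iff forall_2)+ (auto simp: inner_vec_def sum_2)

text \<open>Translates the gauge integral over a simplex in \<open>real^2\<close>, as used by
  \<open>tri_int\<close>, into the Lebesgue integral over pairs that the cone coordinates produce.
  The two hypotheses are the two conclusions of \<open>slice_integrable\<close>.\<close>

lemma integral_std_simplex2:
  fixes g :: "real^2 \<Rightarrow> real"
  assumes g: "(g has_integral (LINT p:interior std_simplex2|lborel. g p)) std_simplex2"
    "set_integrable lborel (interior std_simplex2) g"
  shows "integral std_simplex2 g = (LINT z:open_triangle|lborel. g (vector [fst z, snd z]))"
proof -
  let ?v = "\<lambda>(x, y). vector [x, y] :: real^2"
  have m: "?v \<in> measurable lborel borel"
    by (auto intro!: borel_measurable_continuous_onI continuous_intros simp: case_prod_unfold)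
  have "integral std_simplex2 g = (LINT p|distr lborel borel ?v. indicator (interior std_simplex2) p *\<^sub>R g p)"
    unfolding lborel_vector2 using g(1) by (simp add: integral_unique set_lebesgue_integral_def)
  also have "\<dots> = (LINT z|lborel. indicator (interior std_simplex2) (?v z) *\<^sub>R g (?v z))"
    using borel_measurable_integrable[OF g(2)[unfolded set_integrable_def]] by (intro integral_distr[OF m]) simp
  also have "\<dots> = (LINT z:open_triangle|lborel. g (vector [fst z, snd z]))"
    by (auto simp: set_lebesgue_integral_def interior_std_simplex2 open_triangle_def case_prod_unfold indicator_def
        intro!: Bochner_Integration.integral_cong)
  finally show ?thesis .
qed

text \<open>The integrand is constant in one variable, over which the unit interval contributes a
  factor 1.\<close>

lemma integral_unit_square:
  fixes g :: "real \<Rightarrow> real"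
  assumes g: "(g has_integral (LINT t:{0<..<1}|lborel. g t)) {0..1}"
  shows "set_integrable lborel (box (0, 0) (1, 1)) (\<lambda>z::real\<times>real. g (fst z)) \<Longrightarrow>
      (LINT z:box (0, 0) (1::real, 1::real)|lborel. g (fst z)) = integral {0..1} g"
    and "set_integrable lborel (box (0, 0) (1, 1)) (\<lambda>z::real\<times>real. g (snd z)) \<Longrightarrow>
      (LINT z:box (0, 0) (1::real, 1::real)|lborel. g (snd z)) = integral {0..1} g"
proof -
  have I: "integral {0..1} g = (LINT t|lborel. indicator {0<..<1} t * g t)"
    using g by (simp add: integral_unique set_lebesgue_integral_def)
  have box: "indicator (box (0, 0) (1, 1)) (x, y) = (indicator {0<..<1} x * indicator {0<..<1} y :: real)" for x y :: real
    by (auto simp: indicator_def mem_box Basis_prod_def)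
  let ?J1 = "\<lambda>z::real\<times>real. indicator (box (0, 0) (1, 1)) z * g (fst z)"
  let ?J2 = "\<lambda>z::real\<times>real. indicator (box (0, 0) (1, 1)) z * g (snd z)"
  show "(LINT z:box (0, 0) (1::real, 1::real)|lborel. g (fst z)) = integral {0..1} g"
    if "set_integrable lborel (box (0, 0) (1, 1)) (\<lambda>z::real\<times>real. g (fst z))"
  proof -
    have J: "integrable (lborel \<Otimes>\<^sub>M lborel) ?J1"
      using that by (simp add: set_integrable_def lborel_prod)
    have "(LINT z:box (0, 0) (1::real, 1::real)|lborel. g (fst z)) = (LINT x|lborel. LINT y|lborel. ?J1 (x, y))"
      using lborel_pair.integral_fst'[OF J] by (simp add: lborel_prod set_lebesgue_integral_def)
    also have "\<dots> = (LINT x|lborel. LINT y|lborel. (indicator {0<..<1} x * g x) * indicator {0<..<1::real} y)"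
      by (simp add: box mult_ac)
    also have "\<dots> = integral {0..1} g"
      unfolding I by simp
    finally show ?thesis .
  qed
  show "(LINT z:box (0, 0) (1::real, 1::real)|lborel. g (snd z)) = integral {0..1} g"
    if "set_integrable lborel (box (0, 0) (1, 1)) (\<lambda>z::real\<times>real. g (snd z))"
  proof -
    have J: "integrable (lborel \<Otimes>\<^sub>M lborel) ?J2"
      using that by (simp add: set_integrable_def lborel_prod)
    have "(LINT z:box (0, 0) (1::real, 1::real)|lborel. g (snd z)) = (LINT x|lborel. LINT y|lborel. ?J2 (x, y))"
      using lborel_pair.integral_fst'[OF J] by (simp add: lborel_prod set_lebesgue_integral_def)
    also have "\<dots> = (LINT x|lborel. LINT y|lborel. indicator {0<..<1::real} x * (indicator {0<..<1} y * g y))"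
      by (simp add: box mult_ac)
    also have "\<dots> = integral {0..1} g"
      unfolding I by simp
    finally show ?thesis .
  qed
qed

section \<open>Bounds for one tetrahedron by its faces, sections and edges\<close>

context convex_on_tetrahedron
begin

lemma integrable_T: "f integrable_on T"
  using cone_integral(2) by (rule has_integral_integrable)

lemma triangle_integral:
  fixes X a b :: "real^3"
  assumes "X \<in> T" "a \<in> T" "b \<in> T"
  shows "integral std_simplex2 (\<lambda>p. f (X + p$1 *\<^sub>R (a - X) + p$2 *\<^sub>R (b - X)))
    = (LINT z:open_triangle|lborel. f (X + fst z *\<^sub>R (a - X) + snd z *\<^sub>R (b - X)))"
proof -
  have mem: "X + p$1 *\<^sub>R (a - X) + p$2 *\<^sub>R (b - X) \<in> T" if "p \<in> std_simplex2" for p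
  proof -
    \<comment> \<open>A fourth point with weight 0 is appended to fit
      \<open>convex_combination4\<close>.\<close>
    have eq: "X + p$1 *\<^sub>R (a - X) + p$2 *\<^sub>R (b - X) = (1 - p$1 - p$2) *\<^sub>R X + p$1 *\<^sub>R a + p$2 *\<^sub>R b + 0 *\<^sub>R b"
      by (simp add: algebra_simps)
    show ?thesis
      unfolding eq by (rule convex_combination4[OF convex_on_imp_convex[OF convex_T]])
        (use assms that in \<open>auto simp: std_simplex2_def\<close>)
  qed
  note sl = slice_integrable[OF convex_std_simplex2 bounded_std_simplex2,
      of "\<lambda>p. X + p$1 *\<^sub>R (a - X) + p$2 *\<^sub>R (b - X)"]
  have "((\<lambda>p. f (X + p$1 *\<^sub>R (a - X) + p$2 *\<^sub>R (b - X))) has_integral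
      (LINT p:interior std_simplex2|lborel. f (X + p$1 *\<^sub>R (a - X) + p$2 *\<^sub>R (b - X)))) std_simplex2"
    by (rule sl(2)[OF mem]) (simp_all add: algebra_simps)
  moreover have "set_integrable lborel (interior std_simplex2) (\<lambda>p. f (X + p$1 *\<^sub>R (a - X) + p$2 *\<^sub>R (b - X)))"
    by (rule sl(1)[OF mem]) (simp_all add: algebra_simps)
  ultimately show ?thesis
    by (subst integral_std_simplex2) simp_all
qed

lemma segment_has_integral:
  fixes a b :: "real^3"
  assumes "a \<in> T" "b \<in> T"
  shows "((\<lambda>t. f (a + t *\<^sub>R (b - a))) has_integral (LINT t:{0<..<1}|lborel. f (a + t *\<^sub>R (b - a)))) {0..1}"
proof -
  have mem: "a + t *\<^sub>R (b - a) \<in> T" if "t \<in> {0..1}" for t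
  proof -
    have eq: "a + t *\<^sub>R (b - a) = (1 - t) *\<^sub>R a + t *\<^sub>R b"
      by (simp add: algebra_simps)
    show ?thesis
      unfolding eq using convexD_alt[OF convex_on_imp_convex[OF convex_T] assms] that by auto
  qed
  show ?thesis
    using slice_integrable(2)[of "{0..1::real}" "\<lambda>t. a + t *\<^sub>R (b - a)"] mem
    by (simp add: algebra_simps)
qed

lemma integral_le_vertex_face:
  "integral T f \<le> vol6 * (f P / 24 + integral std_simplex2 (\<lambda>p. f (Q + p$1 *\<^sub>R (R - Q) + p$2 *\<^sub>R (S - Q))) / 4)"
  unfolding triangle_integral[OF vertices_T(2-4)] using cone_upper by (simp add: face_def)

lemma integral_ge_section:
  "vol6 / 3 * integral std_simplex2 (\<lambda>p. f (hom P (3/4) Q + p$1 *\<^sub>R (hom P (3/4) R - hom P (3/4) Q)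
      + p$2 *\<^sub>R (hom P (3/4) S - hom P (3/4) Q))) \<le> integral T f"
proof -
  have hom_T: "hom P (3/4) X \<in> T" if "X \<in> T" for X
  proof -
    have "hom P (3/4) X = (1 - 3/4) *\<^sub>R P + (3/4) *\<^sub>R X"
      unfolding hom_def scaleR_left_diff_distrib scaleR_right_diff_distrib by simp
    then show ?thesis
      using convexD_alt[OF convex_on_imp_convex[OF convex_T] vertices_T(1) that, of "3/4"] by auto
  qed
  \<comment> \<open>The homothetic image of the face is exactly the slice s = 3/4 of the
    cone.\<close>
  have "hom P (3/4) Q + fst z *\<^sub>R (hom P (3/4) R - hom P (3/4) Q)
      + snd z *\<^sub>R (hom P (3/4) S - hom P (3/4) Q) = cone_pt (3/4) z" for z
    by (simp add: hom_def cone_pt_def algebra_simps)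
  then show ?thesis
    unfolding triangle_integral[OF vertices_T(2-4)[THEN hom_T]] using cone_lower by simp
qed

lemma integral_le_opposite_edges:
  "integral T f \<le> vol6 / 12 * (integral {0..1} (\<lambda>t. f (P + t *\<^sub>R (Q - P))) + integral {0..1} (\<lambda>t. f (R + t *\<^sub>R (S - R))))"
  using join_upper
  unfolding integral_unit_square(1)[OF segment_has_integral[OF vertices_T(1,2)] edge_integrable(1)]
    integral_unit_square(2)[OF segment_has_integral[OF vertices_T(3,4)] edge_integrable(2)] .

end

section \<open>Regular polygons and dipyramids\<close>

text \<open>For a constant function the upper and the lower bound agree, which gives the volume.\<close>

lemma integral_tetrahedron_one:
  fixes P Q R S :: "real^3"
  assumes "(Q - P) \<bullet> cross3 (R - P) (S - P) \<noteq> 0"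
  shows "integral (convex hull {P, Q, R, S}) (\<lambda>_. 1) = \<bar>(Q - P) \<bullet> cross3 (R - P) (S - P)\<bar> / 6"
proof -
  interpret convex_on_tetrahedron P Q R S "\<lambda>_. 1"
    by unfold_locales (use assms in \<open>auto simp: convex_on_def simp flip: distrib_right\<close>)
  \<comment> \<open>The bounds meet because 1/24 + 1/8 = 1/6 = 1/3 * 1/2.\<close>
  have "integral T (\<lambda>_. 1) \<le> vol6 * (1 / 24 + 1 / 2 / 4)"
    using cone_upper unfolding open_triangle_const .
  moreover have "vol6 / 3 * (1 / 2) \<le> integral T (\<lambda>_. 1)"
    using cone_lower unfolding open_triangle_const .
  ultimately show ?thesis
    unfolding T_def vol6_def by simp
qed

lemma convex_hull_4_cases:
  assumes "x \<in> convex hull {P, Q, R, S}"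
  obtains a b c d where "a \<ge> 0" "b \<ge> 0" "c \<ge> 0" "d \<ge> 0" "a + b + c + d = 1"
    "x = a *\<^sub>R P + b *\<^sub>R Q + c *\<^sub>R R + d *\<^sub>R S"
proof -
  obtain s y z where "(s, y, z) \<in> cone_domain"
    "x = P + s *\<^sub>R (Q - P) + y *\<^sub>R (R - Q) + z *\<^sub>R (S - Q)"
    using assms unfolding convex_hull_eq_cone by auto
  then show thesis
    by (intro that[of "1 - s" "s - y - z" y z]) (auto simp: cone_domain_def algebra_simps)
qed

lemma sum_shift_periodic:
  fixes g :: "nat \<Rightarrow> real"
  assumes "g n = g 0"
  shows "(\<Sum>k<n. g (Suc k)) = (\<Sum>k<n. g k)"
  using sum.lessThan_Suc_shift[of g n] assms by simp

section \<open>Congruence and separation in the regular polygon\<close>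

locale regular_polygon =
  fixes n :: nat and C u v :: "real^3" and r :: real
  assumes n3: "n \<ge> 3" and r_pos: "r > 0"
    and uu: "u \<bullet> u = 1" and vv: "v \<bullet> v = 1" and uv: "u \<bullet> v = 0"
begin

definition "\<theta> = 2 * pi / real n"

abbreviation "A \<equiv> reg_vertex n C r u v"

lemma vu: "v \<bullet> u = 0"
  using uv by (simp add: inner_commute)

lemma A_eq: "A k = C + r *\<^sub>R (cos (real k * \<theta>) *\<^sub>R u + sin (real k * \<theta>) *\<^sub>R v)"
  by (simp add: reg_vertex_def \<theta>_def mult_ac)

lemma n_pos: "real n > 0"
  using n3 by simp

lemma n_\<theta>: "real n * \<theta> = 2 * pi"
  using n3 by (simp add: \<theta>_def)

lemma \<theta>_bounds: "0 < \<theta>" "\<theta> < pi"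
proof -
  show "0 < \<theta>" using n3 by (simp add: \<theta>_def)
  have "2 * pi < pi * real n" using n3 by simp
  then show "\<theta> < pi" using n3 by (simp add: \<theta>_def field_simps)
qed

lemma sin_\<theta>_pos: "sin \<theta> > 0"
  using \<theta>_bounds by (intro sin_gt_zero) auto

lemma abs_cos_\<theta>: "\<bar>cos \<theta>\<bar> < 1"
proof -
  have "(cos \<theta>)\<^sup>2 < 1"
    using sin_cos_squared_add[of \<theta>] zero_less_power[OF sin_\<theta>_pos, of 2] by linarith
  then show ?thesis
    by (simp add: abs_square_less_1)
qed

lemma A_periodic: "A n = A 0"
  by (simp add: A_eq n_\<theta>)

lemma Suc_\<theta>: "real (Suc k) * \<theta> = real k * \<theta> + \<theta>"
  by (simp add: algebra_simps)

text \<open>For \<open>X\<close> on the axis, X - C is orthogonal to the plane of the polygon and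
  the mixed terms vanish. The result depends on \<open>i\<close> and \<open>j\<close> only through
  their difference, which is the source of the congruence of edges and umbrella triangles.\<close>

lemma inner_A:
  assumes X: "(X - C) \<bullet> u = 0" "(X - C) \<bullet> v = 0"
  shows "(A i - X) \<bullet> (A j - X) = r^2 * cos (real i * \<theta> - real j * \<theta>) + (X - C) \<bullet> (X - C)"
proof -
  define w where "w = X - C"
  have X_eq: "X = C + w" by (simp add: w_def)
  have w: "w \<bullet> u = 0" "w \<bullet> v = 0" "u \<bullet> w = 0" "v \<bullet> w = 0"
    using X by (simp_all add: w_def inner_commute)
  show ?thesis
    unfolding A_eq X_eq
    by (simp add: inner_diff_left inner_diff_right inner_add_left inner_add_right w uu vv uv vu cos_diff power2_eq_square algebra_simps)
qed

lemma dist_apex: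
  assumes X: "(X - C) \<bullet> u = 0" "(X - C) \<bullet> v = 0"
  shows "dist X (A k) = sqrt (r^2 + (X - C) \<bullet> (X - C))" "dist X (A k) > 0"
proof -
  show eq: "dist X (A k) = sqrt (r^2 + (X - C) \<bullet> (X - C))"
    using inner_A[OF X, of k k] unfolding dist_commute[of X] by (simp add: dist_norm norm_eq_sqrt_inner)
  show "dist X (A k) > 0"
    unfolding eq using r_pos by (simp add: add_pos_nonneg)
qed

lemma dist_side: "dist (A k) (A (Suc k)) = sqrt (2 * r^2 * (1 - cos \<theta>))" "dist (A k) (A (Suc k)) > 0"
proof -
  have "(A k - A (Suc k)) \<bullet> (A k - A (Suc k)) =
      (A k - C) \<bullet> (A k - C) + (A (Suc k) - C) \<bullet> (A (Suc k) - C) - 2 * ((A k - C) \<bullet> (A (Suc k) - C))"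
    by (simp add: inner_diff_left inner_diff_right inner_commute algebra_simps)
  also have "\<dots> = 2 * r^2 * (1 - cos \<theta>)"
    using inner_A[of C] by (simp add: Suc_\<theta> algebra_simps)
  finally show eq: "dist (A k) (A (Suc k)) = sqrt (2 * r^2 * (1 - cos \<theta>))"
    by (simp add: dist_norm norm_eq_sqrt_inner)
  show "dist (A k) (A (Suc k)) > 0"
    unfolding eq using r_pos abs_cos_\<theta> by simp
qed

text \<open>By Lagrange's identity the squared norm is the product of the squared lengths minus the
  squared inner product, all of which \<open>inner_A\<close> shows to be independent of
  \<open>k\<close>. Positivity reduces to |cos \<theta>| < 1.\<close>

lemma umbrella_cross:
  assumes X: "(X - C) \<bullet> u = 0" "(X - C) \<bullet> v = 0"
  shows "norm (cross3 (A k - X) (A (Suc k) - X)) = norm (cross3 (A 0 - X) (A 1 - X))"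
    and "norm (cross3 (A 0 - X) (A 1 - X)) > 0"
proof -
  define b where "b = (X - C) \<bullet> (X - C)"
  have b: "b \<ge> 0" by (simp add: b_def)
  have sq: "(norm (cross3 (A k - X) (A (Suc k) - X)))\<^sup>2 = (r^2 + b)\<^sup>2 - (r^2 * cos \<theta> + b)\<^sup>2" for k
  proof -
    have "(norm (cross3 (A k - X) (A (Suc k) - X)))\<^sup>2 + ((A k - X) \<bullet> (A (Suc k) - X))\<^sup>2
        = (norm (A k - X))\<^sup>2 * (norm (A (Suc k) - X))\<^sup>2"
      using norm_cross_dot[of "A k - X" "A (Suc k) - X"] by (simp add: power_mult_distrib)
    also have "\<dots> = (r^2 + b)\<^sup>2"
      using inner_A[OF X] by (simp add: power2_norm_eq_inner b_def) (simp add: power2_eq_square)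
    finally show ?thesis
      using inner_A[OF X, of k "Suc k"] by (simp add: b_def Suc_\<theta> del: of_nat_Suc)
  qed
  show "norm (cross3 (A k - X) (A (Suc k) - X)) = norm (cross3 (A 0 - X) (A 1 - X))"
    by (rule power2_eq_imp_eq) (simp_all only: One_nat_def sq norm_ge_zero)
  have "\<bar>r^2 * cos \<theta> + b\<bar> < \<bar>r^2 + b\<bar>"
  proof -
    have "r^2 * \<bar>cos \<theta>\<bar> < r^2 * 1"
      using abs_cos_\<theta> r_pos by (intro mult_strict_left_mono) auto
    moreover have "\<bar>r^2 * cos \<theta> + b\<bar> \<le> r^2 * \<bar>cos \<theta>\<bar> + b"
      using b abs_triangle_ineq[of "r^2 * cos \<theta>" b] by (simp add: abs_mult)
    ultimately show ?thesis using b by simp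
  qed
  then have "(r^2 * cos \<theta> + b)\<^sup>2 < (r^2 + b)\<^sup>2"
    using power_strict_mono[of "\<bar>r^2 * cos \<theta> + b\<bar>" "\<bar>r^2 + b\<bar>" 2] by simp
  then have "(norm (cross3 (A 0 - X) (A 1 - X)))\<^sup>2 > 0"
    unfolding One_nat_def sq by simp
  then show "norm (cross3 (A 0 - X) (A 1 - X)) > 0"
    by (simp only: zero_less_power2 zero_less_norm_iff norm_eq_zero not_False_eq_True)
qed

text \<open>Cramer's rule in the orthonormal basis \<open>u\<close>, \<open>v\<close>,
  \<open>cross3 u v\<close>: the coefficients of the first two vectors are the inner products of
  \<open>q\<close> with \<open>u\<close> and \<open>v\<close>.\<close>

lemma axis_parallel:
  assumes q: "q \<bullet> u = 0" "q \<bullet> v = 0"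
  shows "q = (q \<bullet> cross3 u v) *\<^sub>R cross3 u v"
proof -
  have "cross3 v (cross3 u v) = u" "cross3 (cross3 u v) u = v"
    using Lagrange[of v u v] Lagrange[of u u v] cross_skew[of "cross3 u v" u]
    by (simp_all add: uu vv uv vu)
  then show ?thesis
    using cross3_Cramer[of u v "cross3 u v" q] q by (simp add: uu)
qed

text \<open>The value does not depend on \<open>k\<close>, so all cells have equal volume. It
  factors into the parallelogram area r^2 sin \<theta> spanned by two consecutive radii and the
  signed length of the axis segment.\<close>

lemma tetrahedron_det:
  assumes X: "(X - C) \<bullet> u = 0" "(X - C) \<bullet> v = 0" and Y: "(Y - C) \<bullet> u = 0" "(Y - C) \<bullet> v = 0"
  shows "(Y - X) \<bullet> cross3 (A k - X) (A (Suc k) - X) = r^2 * sin \<theta> * ((Y - X) \<bullet> cross3 u v)"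
proof -
  define m where "m = cross3 u v"
  define x where "x = (X - C) \<bullet> m"
  define q where "q = (Y - X) \<bullet> m"
  have X_eq: "X = C + x *\<^sub>R m"
    using axis_parallel[OF X] by (simp add: x_def m_def algebra_simps)
  have "(Y - X) \<bullet> u = 0" "(Y - X) \<bullet> v = 0"
    using X Y by (simp_all add: inner_diff_left)
  then have YX: "Y - X = q *\<^sub>R m"
    using axis_parallel[of "Y - X"] by (simp add: q_def m_def)
  define p where "p = r *\<^sub>R (cos (real k * \<theta>) *\<^sub>R u + sin (real k * \<theta>) *\<^sub>R v)"
  define p' where "p' = r *\<^sub>R (cos (real (Suc k) * \<theta>) *\<^sub>R u + sin (real (Suc k) * \<theta>) *\<^sub>R v)"
  have A: "A k - X = p - x *\<^sub>R m" "A (Suc k) - X = p' - x *\<^sub>R m"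
    by (simp_all add: A_eq X_eq p_def p'_def)
  have "cross3 p p' = (r * r) *\<^sub>R ((cos (real k * \<theta>) * sin (real (Suc k) * \<theta>) - sin (real k * \<theta>) * cos (real (Suc k) * \<theta>)) *\<^sub>R m)"
    unfolding p_def p'_def m_def by (simp add: vec_eq_iff forall_3 cross3_def algebra_simps)
  also have "cos (real k * \<theta>) * sin (real (Suc k) * \<theta>) - sin (real k * \<theta>) * cos (real (Suc k) * \<theta>) = sin \<theta>"
    using sin_diff[of "real (Suc k) * \<theta>" "real k * \<theta>"] unfolding Suc_\<theta> by (simp add: mult.commute)
  finally have pp: "cross3 p p' = (r^2 * sin \<theta>) *\<^sub>R m"
    by (simp add: power2_eq_square)
  \<comment> \<open>The height x of the apex drops out: changing vectors by multiples of
    \<open>m\<close> does not affect their triple product with \<open>m\<close>.\<close>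
  have "m \<bullet> cross3 (p - x *\<^sub>R m) (p' - x *\<^sub>R m) = m \<bullet> cross3 p p'"
    by (simp add: cross3_def inner_vec_def sum_3 algebra_simps)
  also have "\<dots> = r^2 * sin \<theta> * (m \<bullet> m)"
    unfolding pp by simp
  finally have "(Y - X) \<bullet> cross3 (A k - X) (A (Suc k) - X) = q * (r^2 * sin \<theta> * (m \<bullet> m))"
    unfolding A YX by simp
  also have "\<dots> = r^2 * sin \<theta> * ((Y - X) \<bullet> m)"
    unfolding YX by simp
  finally show ?thesis
    by (simp add: m_def)
qed

lemma axis_inner_ne_0:
  assumes q: "q \<bullet> u = 0" "q \<bullet> v = 0" "q \<noteq> 0"
  shows "q \<bullet> cross3 u v \<noteq> 0"
  using axis_parallel[OF q(1,2)] q(3) by auto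

text \<open>
  Two distinct cells are separated by a plane through the axis and one of the two vertices A j,
  A (Suc j): which one depends on whether the angle between A j and A k exceeds pi.
\<close>

lemma negligible_tetrahedra_inter_less:
  assumes X: "(X - C) \<bullet> u = 0" "(X - C) \<bullet> v = 0" and Y: "(Y - C) \<bullet> u = 0" "(Y - C) \<bullet> v = 0"
    and jk: "j < k" "k < n"
  shows "negligible (convex hull {X, Y, A j, A (Suc j)} \<inter> convex hull {X, Y, A k, A (Suc k)})"
proof -
  \<comment> \<open>The unit normal of the plane through the axis and \<open>A i\<close>, pointing
    towards increasing angle.\<close>
  define m where "m i = (- sin (real i * \<theta>)) *\<^sub>R u + cos (real i * \<theta>) *\<^sub>R v" for i
  have mm: "m i \<bullet> m i = 1" for i
    by (simp add: m_def inner_diff_left inner_diff_right uu vv uv vu)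
  have m0: "m i \<bullet> (Z - C) = 0" if "(Z - C) \<bullet> u = 0" "(Z - C) \<bullet> v = 0" for Z i
    unfolding m_def inner_add_left inner_scaleR_left inner_commute[of u "Z - C"] inner_commute[of v "Z - C"] that by simp
  have mA: "m i \<bullet> (A k - C) = r * sin (real k * \<theta> - real i * \<theta>)" for i k
    by (simp add: A_eq m_def inner_add_left inner_add_right uu vv uv vu sin_diff algebra_simps)
  have coord: "\<exists>c d. c \<ge> 0 \<and> d \<ge> 0 \<and> (\<forall>i. m i \<bullet> (x - C) =
      r * (c * sin (real k * \<theta> - real i * \<theta>) + d * sin (real (Suc k) * \<theta> - real i * \<theta>)))"
    if x: "x \<in> convex hull {X, Y, A k, A (Suc k)}" for x k
  proof -
    obtain a b c d where abcd: "a \<ge> 0" "b \<ge> 0" "c \<ge> 0" "d \<ge> 0" "a + b + c + d = 1"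
      and x_eq: "x = a *\<^sub>R X + b *\<^sub>R Y + c *\<^sub>R A k + d *\<^sub>R A (Suc k)"
      using convex_hull_4_cases[OF x] by blast
    have "x - C = x - (a + b + c + d) *\<^sub>R C"
      using abcd by simp
    also have "\<dots> = a *\<^sub>R (X - C) + b *\<^sub>R (Y - C) + c *\<^sub>R (A k - C) + d *\<^sub>R (A (Suc k) - C)"
      unfolding x_eq by (simp add: algebra_simps)
    finally have "m i \<bullet> (x - C) =
        r * (c * sin (real k * \<theta> - real i * \<theta>) + d * sin (real (Suc k) * \<theta> - real i * \<theta>))" for i
      by (simp only: inner_add_right inner_scaleR_right m0[OF X] m0[OF Y] mA) (simp add: algebra_simps)
    then show ?thesis
      using abcd by blast
  qed
  let ?h = "real k * \<theta> - real j * \<theta>"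
  have h_eq: "?h = real (k - j) * \<theta>"
    using jk by (simp add: of_nat_diff algebra_simps)
  have h_ge: "\<theta> \<le> ?h"
    using jk \<theta>_bounds unfolding h_eq by simp
  \<comment> \<open>Since k < n, the cell k ends no later than one full turn after
    \<open>A j\<close>. Equality occurs for the first and the last cell, which share a face.\<close>
  have h_le: "?h + \<theta> \<le> 2 * pi"
  proof -
    have "real (k - j + 1) * \<theta> \<le> real n * \<theta>"
      using jk \<theta>_bounds by (intro mult_right_mono) auto
    then show ?thesis
      unfolding h_eq n_\<theta> by (simp add: algebra_simps)
  qed
  have arg: "real j * \<theta> - real (Suc j) * \<theta> = - \<theta>" "real (Suc j) * \<theta> - real j * \<theta> = \<theta>"
    "real k * \<theta> - real (Suc j) * \<theta> = ?h - \<theta>" "real (Suc k) * \<theta> - real (Suc j) * \<theta> = ?h"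
    "real (Suc k) * \<theta> - real j * \<theta> = ?h + \<theta>"
    by (simp_all add: algebra_simps)
  have "m (Suc j) \<bullet> (x - C) = 0 \<or> m j \<bullet> (x - C) = 0"
    if x: "x \<in> convex hull {X, Y, A j, A (Suc j)}" "x \<in> convex hull {X, Y, A k, A (Suc k)}" for x
  proof -
    obtain c d where cd: "c \<ge> 0" "d \<ge> 0" "\<And>i. m i \<bullet> (x - C) =
      r * (c * sin (real j * \<theta> - real i * \<theta>) + d * sin (real (Suc j) * \<theta> - real i * \<theta>))"
      using coord[OF x(1)] by blast
    obtain c' d' where cd': "c' \<ge> 0" "d' \<ge> 0" "\<And>i. m i \<bullet> (x - C) =
      r * (c' * sin (real k * \<theta> - real i * \<theta>) + d' * sin (real (Suc k) * \<theta> - real i * \<theta>))"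
      using coord[OF x(2)] by blast
    \<comment> \<open>Measured from \<open>A (Suc j)\<close>, cell j covers the angles from
      -\<theta> to 0 and cell k those from ?h - \<theta> to ?h. If ?h \<le> pi, the latter lie in
      [0, pi] and \<open>m (Suc j)\<close> has weakly opposite signs on the cells. Otherwise,
      measured from \<open>A j\<close>, cell k covers ?h to ?h + \<theta> within [pi, 2 pi], and
      \<open>m j\<close> separates.\<close>
    show ?thesis
    proof (cases "?h \<le> pi")
      case True
      have "m (Suc j) \<bullet> (x - C) = - (r * (c * sin \<theta>))"
        unfolding cd(3) arg by simp
      also have "\<dots> \<le> 0"
        using cd(1) r_pos sin_\<theta>_pos by simp
      finally have "m (Suc j) \<bullet> (x - C) \<le> 0" .
      moreover have "sin (?h - \<theta>) \<ge> 0" "sin ?h \<ge> 0"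
        using True h_ge \<theta>_bounds by (intro sin_ge_zero; linarith)+
      then have "m (Suc j) \<bullet> (x - C) \<ge> 0"
        unfolding cd'(3) arg using cd'(1,2) r_pos by (intro mult_nonneg_nonneg add_nonneg_nonneg) auto
      ultimately show ?thesis by simp
    next
      case False
      have "m j \<bullet> (x - C) = r * (d * sin \<theta>)"
        unfolding cd(3) arg by simp
      also have "\<dots> \<ge> 0"
        using cd(2) r_pos sin_\<theta>_pos by simp
      finally have "m j \<bullet> (x - C) \<ge> 0" .
      moreover have "sin ?h \<le> 0" "sin (?h + \<theta>) \<le> 0"
        using False h_le \<theta>_bounds sin_ge_zero[of "?h - pi"] sin_ge_zero[of "?h + \<theta> - pi"]
        unfolding sin_diff[of _ pi] by auto
      then have "m j \<bullet> (x - C) \<le> 0"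
        unfolding cd'(3) arg using cd'(1,2) r_pos
        by (intro mult_nonneg_nonpos add_nonpos_nonpos) auto
      ultimately show ?thesis by simp
    qed
  qed
  then have "convex hull {X, Y, A j, A (Suc j)} \<inter> convex hull {X, Y, A k, A (Suc k)}
      \<subseteq> {x. m (Suc j) \<bullet> x = m (Suc j) \<bullet> C} \<union> {x. m j \<bullet> x = m j \<bullet> C}"
    by (auto simp: inner_diff_right)
  moreover have "m i \<noteq> 0" for i
    using mm[of i] by auto
  then have "negligible ({x. m (Suc j) \<bullet> x = m (Suc j) \<bullet> C} \<union> {x. m j \<bullet> x = m j \<bullet> C})"
    by (intro negligible_Un negligible_hyperplane) auto
  ultimately show ?thesis
    by (rule negligible_subset[rotated])
qed

end

text \<open>All pieces share the parametrization factor \<open>c\<close> and the measure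
  \<open>c / d\<close>, so \<open>c\<close> cancels. The case d = 2 is for triangles, whose area is
  half the norm of the cross product, and d = 1 is for segments.\<close>

lemma const_weight_average:
  fixes J :: "nat \<Rightarrow> real"
  assumes "c \<noteq> 0" "n > 0"
  shows "(\<Sum>k<n. c * J k) / (\<Sum>k<n. c / d) = d * (\<Sum>k<n. J k) / real n"
  using assms by (simp add: sum_distrib_left[symmetric])

context regular_polygon
begin

lemma umbrella_avg_eq:
  assumes X: "(X - C) \<bullet> u = 0" "(X - C) \<bullet> v = 0"
  shows "umbrella_avg f n X A = 2 * (\<Sum>k<n. integral std_simplex2
    (\<lambda>p. f (X + p$1 *\<^sub>R (A k - X) + p$2 *\<^sub>R (A (Suc k) - X)))) / real n"
  unfolding umbrella_avg_def tri_int_def tri_area_def umbrella_cross(1)[OF X]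
  using umbrella_cross(2)[OF X] n_pos by (intro const_weight_average) auto

text \<open>The homothety multiplies every area by (3/4)^2 = 9/16, so the triangles still have a
  common weight, which cancels as before.\<close>

lemma umbrella_avg_hom_eq:
  assumes X: "(X - C) \<bullet> u = 0" "(X - C) \<bullet> v = 0"
  shows "umbrella_avg f n (hom Y (3/4) X) (\<lambda>k. hom Y (3/4) (A k)) = 2 * (\<Sum>k<n. integral std_simplex2
    (\<lambda>p. f (hom Y (3/4) X + p$1 *\<^sub>R (hom Y (3/4) (A k) - hom Y (3/4) X)
      + p$2 *\<^sub>R (hom Y (3/4) (A (Suc k)) - hom Y (3/4) X)))) / real n"
proof -
  have hom_diff: "hom Y (3/4) a - hom Y (3/4) b = (3/4) *\<^sub>R (a - b)" for a b
    by (simp add: hom_def algebra_simps)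
  have cross: "norm (cross3 (hom Y (3/4) (A k) - hom Y (3/4) X) (hom Y (3/4) (A (Suc k)) - hom Y (3/4) X))
      = 9/16 * norm (cross3 (A 0 - X) (A 1 - X))" for k
    unfolding hom_diff cross_mult_left cross_mult_right norm_scaleR umbrella_cross(1)[OF X] by simp
  show ?thesis
    unfolding umbrella_avg_def tri_int_def tri_area_def cross
    using umbrella_cross(2)[OF X] n_pos by (intro const_weight_average) auto
qed

lemma boundary_avg_eq:
  "boundary_avg f n A = (\<Sum>k<n. integral {0..1} (\<lambda>t. f (A k + t *\<^sub>R (A (Suc k) - A k)))) / real n"
proof -
  define s where "s = sqrt (2 * r^2 * (1 - cos \<theta>))"
  have "s \<noteq> 0"
    using dist_side[of 0] by (simp only: s_def)
  then show ?thesis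
    unfolding boundary_avg_def seg_int_def dist_side(1) s_def[symmetric]
    using const_weight_average[of s n _ 1] n_pos by simp
qed

lemma scaffold_avg_eq:
  assumes X: "(X - C) \<bullet> u = 0" "(X - C) \<bullet> v = 0"
  shows "scaffold_avg f n X A = (\<Sum>k<n. integral {0..1} (\<lambda>t. f (X + t *\<^sub>R (A k - X)))) / real n"
  using const_weight_average[of "sqrt (r^2 + (X - C) \<bullet> (X - C))" n _ 1] dist_apex[OF X] n_pos
  unfolding scaffold_avg_def seg_int_def dist_apex(1)[OF X] by simp

end

section \<open>Summation over the cells of the dipyramid\<close>

locale convex_on_regular_dipyramid = regular_polygon n C u v r
  for n and C u v :: "real^3" and r +
  fixes X Y :: "real^3" and f :: "real^3 \<Rightarrow> real"
  assumes X: "(X - C) \<bullet> u = 0" "(X - C) \<bullet> v = 0"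
    and Y: "(Y - C) \<bullet> u = 0" "(Y - C) \<bullet> v = 0"
    and XY: "X \<noteq> Y"
    and f_convex: "\<And>k. k < n \<Longrightarrow> convex_on (convex hull {X, Y, A k, A (Suc k)}) f"
begin

text \<open>The common value of \<open>vol6\<close> on all cells, six times the volume of
  each.\<close>

definition "V = \<bar>r^2 * sin \<theta> * ((Y - X) \<bullet> cross3 u v)\<bar>"

lemma V_pos: "V > 0"
proof -
  have "(Y - X) \<bullet> cross3 u v \<noteq> 0"
    using X Y XY by (intro axis_inner_ne_0) (auto simp: inner_diff_left)
  then show ?thesis
    using r_pos sin_\<theta>_pos by (simp add: V_def)
qed

lemma cells:
  shows "\<bar>(Y - X) \<bullet> cross3 (A k - X) (A (Suc k) - X)\<bar> = V"
    and "\<bar>(A k - X) \<bullet> cross3 (Y - X) (A (Suc k) - X)\<bar> = V"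
proof -
  show 1: "\<bar>(Y - X) \<bullet> cross3 (A k - X) (A (Suc k) - X)\<bar> = V"
    unfolding tetrahedron_det[OF X Y] V_def ..
  have "(A k - X) \<bullet> cross3 (Y - X) (A (Suc k) - X) = - ((Y - X) \<bullet> cross3 (A k - X) (A (Suc k) - X))"
    by (simp add: cross3_def inner_vec_def sum_3 algebra_simps)
  then show "\<bar>(A k - X) \<bullet> cross3 (Y - X) (A (Suc k) - X)\<bar> = V"
    using 1 by simp
qed

text \<open>One cell in two vertex orders: in the first the axis \<open>X\<close>, \<open>Y\<close>
  is opposite to a side of the polygon and \<open>X\<close> is the apex over an umbrella triangle;
  in the second the edge from \<open>X\<close> to \<open>A k\<close> is opposite to the edge from
  \<open>Y\<close> to \<open>A (Suc k)\<close>.\<close>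

lemma cell_locale:
  assumes "k < n"
  shows "convex_on_tetrahedron X Y (A k) (A (Suc k)) f"
    and "convex_on_tetrahedron X (A k) Y (A (Suc k)) f"
proof -
  have eq: "{X, A k, Y, A (Suc k)} = {X, Y, A k, A (Suc k)}"
    by auto
  show "convex_on_tetrahedron X Y (A k) (A (Suc k)) f"
    using cells[of k] V_pos f_convex[OF assms] by unfold_locales auto
  show "convex_on_tetrahedron X (A k) Y (A (Suc k)) f"
    using cells[of k] V_pos f_convex[OF assms] by unfold_locales (auto simp: eq)
qed

definition "cell k = convex hull {X, Y, A k, A (Suc k)}"

lemma negligible_cells: "pairwise (\<lambda>j k. negligible (cell j \<inter> cell k)) {..<n}"
  using negligible_tetrahedra_inter_less[OF X Y]
  unfolding pairwise_def cell_def by (metis Int_commute lessThan_iff linorder_less_linear)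

lemma dipyramid_cells: "dipyramid n A X Y = (\<Union>k<n. cell k)"
  by (simp add: dipyramid_def cell_def)

lemma measure_dipyramid: "measure lebesgue (dipyramid n A X Y) = real n * V / 6"
proof -
  have "dipyramid n A X Y \<in> lmeasurable"
    unfolding dipyramid_cells cell_def
    by (intro lmeasurable_compact compact_UN compact_convex_hull finite_imp_compact) auto
  then have "measure lebesgue (dipyramid n A X Y) = integral (dipyramid n A X Y) (\<lambda>_. 1)"
    by (rule lmeasure_integral)
  also have "\<dots> = (\<Sum>k<n. V / 6)"
    unfolding dipyramid_cells
  proof (rule integral_unique[OF has_integral_UN[OF _ _ negligible_cells]])
    fix k
    have c: "(Y - X) \<bullet> cross3 (A k - X) (A (Suc k) - X) \<noteq> 0"
      using cells(1)[of k] V_pos by auto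
    have "(\<lambda>_. 1 :: real) integrable_on cell k"
      unfolding cell_def by (intro integrable_on_const lmeasurable_compact compact_convex_hull finite_imp_compact) simp
    then show "((\<lambda>_. 1) has_integral V / 6) (cell k)"
      using integral_tetrahedron_one[OF c] cells(1)[of k] by (simp add: has_integral_iff cell_def)
  qed simp
  finally show ?thesis by simp
qed

lemma vol_avg_dipyramid: "vol_avg f (dipyramid n A X Y) = 6 / (real n * V) * (\<Sum>k<n. integral (cell k) f)"
proof -
  have "integral (dipyramid n A X Y) f = (\<Sum>k<n. integral (cell k) f)"
    unfolding dipyramid_cells
  proof (rule integral_unique[OF has_integral_UN[OF _ _ negligible_cells]])
    fix k assume "k \<in> {..<n}"
    then show "(f has_integral integral (cell k) f) (cell k)"
      using convex_on_tetrahedron.integrable_T[OF cell_locale(1)]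
      by (simp add: convex_on_tetrahedron.T_def[OF cell_locale(1)] cell_def integrable_integral)
  qed simp
  then show ?thesis
    by (simp add: vol_avg_def measure_dipyramid)
qed

text \<open>The total volume is n V / 6, so bounds V * a k on the cells become six times the mean of
  the a k.\<close>

lemma vol_avg_le:
  assumes "\<And>k. k < n \<Longrightarrow> integral (cell k) f \<le> V * a k"
  shows "vol_avg f (dipyramid n A X Y) \<le> 6 * (\<Sum>k<n. a k) / real n"
proof -
  have "(\<Sum>k<n. integral (cell k) f) \<le> V * (\<Sum>k<n. a k)"
    unfolding sum_distrib_left using assms by (intro sum_mono) auto
  then have "6 / (real n * V) * (\<Sum>k<n. integral (cell k) f) \<le> 6 / (real n * V) * (V * (\<Sum>k<n. a k))"
    using V_pos by (intro mult_left_mono) auto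
  also have "\<dots> = 6 * (\<Sum>k<n. a k) / real n"
    using V_pos by simp
  finally show ?thesis
    by (simp add: vol_avg_dipyramid)
qed

lemma vol_avg_ge:
  assumes "\<And>k. k < n \<Longrightarrow> V * a k \<le> integral (cell k) f"
  shows "6 * (\<Sum>k<n. a k) / real n \<le> vol_avg f (dipyramid n A X Y)"
proof -
  have "V * (\<Sum>k<n. a k) \<le> (\<Sum>k<n. integral (cell k) f)"
    unfolding sum_distrib_left using assms by (intro sum_mono) auto
  then have "6 / (real n * V) * (V * (\<Sum>k<n. a k)) \<le> 6 / (real n * V) * (\<Sum>k<n. integral (cell k) f)"
    using V_pos by (intro mult_left_mono) auto
  then show ?thesis
    using V_pos by (simp add: vol_avg_dipyramid)
qed

lemma vol6_cell: "k < n \<Longrightarrow> convex_on_tetrahedron.vol6 X Y (A k) (A (Suc k)) = V"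
  "k < n \<Longrightarrow> convex_on_tetrahedron.vol6 X (A k) Y (A (Suc k)) = V"
  by (simp_all add: convex_on_tetrahedron.vol6_def[OF cell_locale(1)] convex_on_tetrahedron.vol6_def[OF cell_locale(2)] cells)

lemma T_cell: "k < n \<Longrightarrow> convex_on_tetrahedron.T X Y (A k) (A (Suc k)) = cell k"
  "k < n \<Longrightarrow> convex_on_tetrahedron.T X (A k) Y (A (Suc k)) = cell k"
  by (simp_all add: convex_on_tetrahedron.T_def[OF cell_locale(1)] convex_on_tetrahedron.T_def[OF cell_locale(2)]
      cell_def insert_commute)

lemma vol_avg_le_apex_umbrella:
  "vol_avg f (dipyramid n A X Y) \<le> 1/4 * f X + 3/4 * umbrella_avg f n Y A"
proof -
  let ?J = "\<lambda>k. integral std_simplex2 (\<lambda>p. f (Y + p$1 *\<^sub>R (A k - Y) + p$2 *\<^sub>R (A (Suc k) - Y)))"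
  have "vol_avg f (dipyramid n A X Y) \<le> 6 * (\<Sum>k<n. f X / 24 + ?J k / 4) / real n"
    using convex_on_tetrahedron.integral_le_vertex_face[OF cell_locale(1)]
    by (intro vol_avg_le) (simp add: T_cell vol6_cell)
  \<comment> \<open>Here 6/24 = 1/4 and 6/4 = 3/4 * 2, where 2 is the factor in
    \<open>umbrella_avg_eq\<close>.\<close>
  also have "\<dots> = 1/4 * f X + 3/4 * umbrella_avg f n Y A"
    unfolding umbrella_avg_eq[OF Y] sum.distrib sum_divide_distrib[symmetric] using n_pos
    by (simp add: add_divide_distrib distrib_left)
  finally show ?thesis .
qed

lemma umbrella_hom_le_vol_avg:
  "umbrella_avg f n (hom X (3/4) Y) (\<lambda>k. hom X (3/4) (A k)) \<le> vol_avg f (dipyramid n A X Y)"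
proof -
  let ?J = "\<lambda>k. integral std_simplex2 (\<lambda>p. f (hom X (3/4) Y + p$1 *\<^sub>R (hom X (3/4) (A k) - hom X (3/4) Y)
      + p$2 *\<^sub>R (hom X (3/4) (A (Suc k)) - hom X (3/4) Y)))"
  have "6 * (\<Sum>k<n. ?J k / 3) / real n \<le> vol_avg f (dipyramid n A X Y)"
    using convex_on_tetrahedron.integral_ge_section[OF cell_locale(1)]
    by (intro vol_avg_ge) (simp add: T_cell vol6_cell)
  then show ?thesis
    unfolding umbrella_avg_hom_eq[OF Y] by (simp add: sum_divide_distrib[symmetric])
qed

lemma vol_avg_le_axis_boundary:
  "vol_avg f (dipyramid n A X Y) \<le> 1/2 * (seg_avg f X Y + boundary_avg f n A)"
proof -
  let ?E = "\<lambda>a b. integral {0..1} (\<lambda>t. f (a + t *\<^sub>R (b - a)))"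
  have "vol_avg f (dipyramid n A X Y) \<le> 6 * (\<Sum>k<n. (?E X Y + ?E (A k) (A (Suc k))) / 12) / real n"
    using convex_on_tetrahedron.integral_le_opposite_edges[OF cell_locale(1)]
    by (intro vol_avg_le) (simp add: T_cell vol6_cell)
  \<comment> \<open>The axis belongs to every cell, so the mean over k leaves its integral
    unchanged; 6/12 gives the factor 1/2.\<close>
  also have "\<dots> = 1/2 * (seg_avg f X Y + boundary_avg f n A)"
    unfolding boundary_avg_eq seg_avg_def seg_int_def using n_pos XY
    by (simp add: sum.distrib sum_divide_distrib[symmetric] field_simps)
  finally show ?thesis .
qed

text \<open>Pairing \<open>X\<close>, \<open>A k\<close> with \<open>Y\<close>,
  \<open>A (Suc k)\<close> uses every edge of each scaffold exactly once as k runs through the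
  cells; periodicity undoes the index shift in the second sum.\<close>

lemma vol_avg_le_scaffolds:
  "vol_avg f (dipyramid n A X Y) \<le> 1/2 * (scaffold_avg f n X A + scaffold_avg f n Y A)"
proof -
  let ?E = "\<lambda>a b. integral {0..1} (\<lambda>t. f (a + t *\<^sub>R (b - a)))"
  have "vol_avg f (dipyramid n A X Y) \<le> 6 * (\<Sum>k<n. (?E X (A k) + ?E Y (A (Suc k))) / 12) / real n"
    using convex_on_tetrahedron.integral_le_opposite_edges[OF cell_locale(2)]
    by (intro vol_avg_le) (simp add: T_cell vol6_cell)
  also have "\<dots> = 1/2 * (((\<Sum>k<n. ?E X (A k)) + (\<Sum>k<n. ?E Y (A (Suc k)))) / real n)"
    unfolding sum.distrib sum_divide_distrib[symmetric] by (simp add: add_divide_distrib)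
  also have "(\<Sum>k<n. ?E Y (A (Suc k))) = (\<Sum>k<n. ?E Y (A k))"
    by (rule sum_shift_periodic) (simp add: A_periodic)
  finally show ?thesis
    unfolding scaffold_avg_eq[OF X] scaffold_avg_eq[OF Y] by (simp add: add_divide_distrib)
qed

end

theorem theorem7p1:
  fixes n :: nat and C u v O0 O1 :: "real^3" and r :: real and f :: "real^3 \<Rightarrow> real"
  defines "A \<equiv> reg_vertex n C r u v"
  defines "D \<equiv> dipyramid n A O0 O1"
  assumes n3: "n \<ge> 3"
    and r_pos: "r > 0"
    and u_unit: "norm u = 1" and v_unit: "norm v = 1" and uv_orth: "u \<bullet> v = 0"
    and O0_on_l: "(O0 - C) \<bullet> u = 0 \<and> (O0 - C) \<bullet> v = 0"
    and O1_on_l: "(O1 - C) \<bullet> u = 0 \<and> (O1 - C) \<bullet> v = 0"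
    and O0_off: "O0 \<noteq> C" and O1_off: "O1 \<noteq> C"
    and O01: "O0 \<noteq> O1"
    and f_convex: "\<forall>k<n. convex_on (convex hull {O0, O1, A k, A (Suc k)}) f"
  shows "vol_avg f D \<le> 1/4 * f O0 + 3/4 * umbrella_avg f n O1 A \<and>
    vol_avg f D \<le> 1/4 * f O1 + 3/4 * umbrella_avg f n O0 A \<and>
    umbrella_avg f n (hom O0 (3/4) O1) (\<lambda>k. hom O0 (3/4) (A k)) \<le> vol_avg f D \<and>
    umbrella_avg f n (hom O1 (3/4) O0) (\<lambda>k. hom O1 (3/4) (A k)) \<le> vol_avg f D \<and>
    vol_avg f D \<le> 1/2 * (seg_avg f O0 O1 + boundary_avg f n A) \<and>
    vol_avg f D \<le> 1/2 * (scaffold_avg f n O0 A + scaffold_avg f n O1 A)"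
proof -
  interpret regular_polygon n C u v r
    using n3 r_pos u_unit v_unit uv_orth by unfold_locales (auto simp: norm_eq_1)
  interpret c01: convex_on_regular_dipyramid n C u v r O0 O1 f
    using O0_on_l O1_on_l O01 f_convex by unfold_locales (auto simp: A_def)
  \<comment> \<open>Exchanging the apices leaves the cells and the dipyramid unchanged, and yields
    the mirror images of the two inequalities that distinguish between the apices.\<close>
  interpret c10: convex_on_regular_dipyramid n C u v r O1 O0 f
    using O0_on_l O1_on_l O01 f_convex by unfold_locales (auto simp: A_def insert_commute)
  have D10: "D = dipyramid n (reg_vertex n C r u v) O1 O0"
    by (simp add: D_def A_def dipyramid_def insert_commute)
  show ?thesis
    using c01.vol_avg_le_apex_umbrella c10.vol_avg_le_apex_umbrella[folded D10]
      c01.umbrella_hom_le_vol_avg c10.umbrella_hom_le_vol_avg[folded D10]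
      c01.vol_avg_le_axis_boundary c01.vol_avg_le_scaffolds
    unfolding D_def A_def by blast
qed

end
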